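(* Let $Z\subset\mathbb R^d$ be a $d$-dimensional zonotope that is a parallelohedron. Let $\mathcal T(Z)$ be the face-to-face tiling of $\mathbb R^d$ by parallel translates of $Z$, and let $\Lambda(Z)$ be the lattice formed by the centers of the tiles. Let $\mathcal N(Z)$ be the set of vectors connecting the center of $Z$ with the centers of those tiles of $\mathcal T(Z)$ that share a facet with $Z$. Then one can choose $d$ vectors from $\mathcal N(Z)$ that form a basis of the lattice $\Lambda(Z)$.
   Context: A zonotope is a Minkowski sum of finitely many segments. A polytope $P\subset\mathbb R^d$ is a parallelohedron if $\mathbb R^d$ can be tiled by non-overlapping parallel translates of $P$. A tiling is face-to-face if the intersection of any two tiles is a (possibly empty) face of both. Every parallelohedron admits a face-to-face tiling by its translates, which is unique up to translation, and the centers of its tiles form a $d$-dimensional lattice. *)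

theory Defs
  imports "HOL-Analysis.Analysis"
begin

text \<open>The sum below is the Minkowski sum of sets.\<close>

definition zonotope :: "'a::euclidean_space set \<Rightarrow> bool" where
  "zonotope Z \<longleftrightarrow>
     (\<exists>(n::nat) (a :: nat \<Rightarrow> 'a) b. Z = (\<Sum>i<n. closed_segment (a i) (b i)))"

definition tiling_by_translates :: "'a::euclidean_space set \<Rightarrow> 'a set set \<Rightarrow> bool" where
  "tiling_by_translates P \<T> \<longleftrightarrow>
     (\<forall>A\<in>\<T>. \<exists>t. A = (+) t ` P) \<and>
     \<Union>\<T> = UNIV \<and>
     (\<forall>A\<in>\<T>. \<forall>B\<in>\<T>. A \<noteq> B \<longrightarrow> interior A \<inter> interior B = {})"

text \<open>Tiles are full-dimensional; without this condition a single point would qualify as a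
  parallelohedron, its translates having empty interiors.\<close>

definition parallelohedron :: "'a::euclidean_space set \<Rightarrow> bool" where
  "parallelohedron P \<longleftrightarrow>
     polytope P \<and> aff_dim P = int DIM('a) \<and> (\<exists>\<T>. tiling_by_translates P \<T>)"

definition face_to_face :: "'a::euclidean_space set set \<Rightarrow> bool" where
  "face_to_face \<T> \<longleftrightarrow>
     (\<forall>A\<in>\<T>. \<forall>B\<in>\<T>. (A \<inter> B) face_of A \<and> (A \<inter> B) face_of B)"

definition center_of_symmetry :: "'a::euclidean_space set \<Rightarrow> 'a \<Rightarrow> bool" where
  "center_of_symmetry P c \<longleftrightarrow> (\<lambda>x. 2 *\<^sub>R c - x) ` P = P"

definition center :: "'a::euclidean_space set \<Rightarrow> 'a" where
  "center P = (THE c. center_of_symmetry P c)"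

text \<open>Centers are taken relative to the center of the tile \<open>Z\<close>, so that the set is a lattice
  (and not merely a translate of one) wherever \<open>Z\<close> is located; if \<open>Z\<close> is centered at the origin,
  it is the set of centers of the tiles.\<close>

definition center_lattice :: "'a::euclidean_space set \<Rightarrow> 'a set set \<Rightarrow> 'a set" where
  "center_lattice Z \<T> = {center A - center Z | A. A \<in> \<T>}"

definition facet_vectors :: "'a::euclidean_space set \<Rightarrow> 'a set set \<Rightarrow> 'a set" where
  "facet_vectors Z \<T> =
     {center A - center Z | A. A \<in> \<T> \<and> A \<noteq> Z \<and> (\<exists>F. F facet_of Z \<and> F facet_of A)}"

definition lattice_basis :: "'a::euclidean_space set \<Rightarrow> 'a set \<Rightarrow> bool" where
  "lattice_basis B L \<longleftrightarrow>
     finite B \<and> independent B \<and>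
     L = {\<Sum>b\<in>B. of_int (k b) *\<^sub>R b | k :: 'a \<Rightarrow> int. True}"

text \<open>The following facts show that the definite description in \<^const>\<open>center\<close> is well-defined
  for zonotopes, hence for their translates.\<close>

lemma center_of_symmetry_unique:
  fixes P :: "'a::euclidean_space set"
  assumes "bounded P" "P \<noteq> {}" and c: "center_of_symmetry P c" and d: "center_of_symmetry P d"
  shows "c = d"
proof -
  define v where "v = 2 *\<^sub>R (c - d)"
  have step: "x + v \<in> P" if "x \<in> P" for x
  proof -
    have "2 *\<^sub>R d - x \<in> P" using d that unfolding center_of_symmetry_def by blast
    then have "2 *\<^sub>R c - (2 *\<^sub>R d - x) \<in> P" using c unfolding center_of_symmetry_def by blast
    then show ?thesis by (simp add: v_def algebra_simps)
  qed
  obtain x where x: "x \<in> P" using assms by blast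
  have it: "x + real n *\<^sub>R v \<in> P" for n
  proof (induction n)
    case (Suc n)
    from step[OF this] show ?case by (simp add: algebra_simps)
  qed (simp add: x)
  obtain M where M: "\<And>y. y \<in> P \<Longrightarrow> norm y \<le> M" using \<open>bounded P\<close> bounded_iff by blast
  have "v = 0"
  proof (rule ccontr)
    assume "v \<noteq> 0"
    then obtain n :: nat where n: "2 * M < real n * norm v"
      using reals_Archimedean3[of "norm v"] by auto
    have "norm (real n *\<^sub>R v) \<le> norm (x + real n *\<^sub>R v) + norm x"
      using norm_triangle_ineq4[of "x + real n *\<^sub>R v" x] by simp
    also have "\<dots> \<le> 2 * M" using M[OF it[of n]] M[OF x] by simp
    finally show False using n by simp
  qed
  then show ?thesis by (simp add: v_def)
qed

lemma center_eqI:
  assumes "bounded P" "P \<noteq> {}" "center_of_symmetry P c"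
  shows "center P = c"
  unfolding center_def using assms center_of_symmetry_unique by blast

lemma center_of_symmetry_plus:
  assumes "center_of_symmetry P c" "center_of_symmetry Q d"
  shows "center_of_symmetry (P + Q) (c + d)"
proof -
  have sub: "(\<lambda>x. 2 *\<^sub>R (c + d) - x) ` (P + Q) \<subseteq> P + Q"
  proof
    fix y assume "y \<in> (\<lambda>x. 2 *\<^sub>R (c + d) - x) ` (P + Q)"
    then obtain p q where pq: "p \<in> P" "q \<in> Q" "y = 2 *\<^sub>R (c + d) - (p + q)"
      by (auto simp: set_plus_def)
    have "2 *\<^sub>R c - p \<in> P" "2 *\<^sub>R d - q \<in> Q"
      using assms pq unfolding center_of_symmetry_def by blast+
    moreover have "y = (2 *\<^sub>R c - p) + (2 *\<^sub>R d - q)" using pq by (simp add: algebra_simps)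
    ultimately show "y \<in> P + Q" by (auto simp: set_plus_def)
  qed
  have "y \<in> (\<lambda>x. 2 *\<^sub>R (c + d) - x) ` (P + Q)" if "y \<in> P + Q" for y
  proof
    show "2 *\<^sub>R (c + d) - y \<in> P + Q" using sub that by blast
  qed simp
  with sub show ?thesis unfolding center_of_symmetry_def by blast
qed

lemma zonotope_center_exists:
  fixes Z :: "'a::euclidean_space set"
  assumes "zonotope Z"
  shows "\<exists>c. center_of_symmetry Z c"
proof -
  have seg: "center_of_symmetry (closed_segment a b) (midpoint a b)" for a b :: 'a
  proof -
    have "(\<lambda>x. 2 *\<^sub>R midpoint a b - x) ` closed_segment a b = closed_segment b a"
    proof -
      have "(\<lambda>x. 2 *\<^sub>R midpoint a b - x) ` closed_segment a b
          = (+) (a + b) ` uminus ` closed_segment a b"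
        by (simp add: image_image midpoint_def)
      also have "uminus ` closed_segment a b = closed_segment (- a) (- b)"
        by (rule closed_segment_linear_image[symmetric]) (simp add: linear_uminus)
      also have "(+) (a + b) ` \<dots> = closed_segment b a"
        using closed_segment_translation[of "a + b" "- a" "- b"] by simp
      finally show ?thesis .
    qed
    then show ?thesis by (simp add: center_of_symmetry_def closed_segment_commute)
  qed
  obtain n and a b :: "nat \<Rightarrow> 'a" where Z: "Z = (\<Sum>i<n. closed_segment (a i) (b i))"
    using assms unfolding zonotope_def by blast
  have "\<exists>c. center_of_symmetry (\<Sum>i<n. closed_segment (a i) (b i)) c"
  proof (induction n)
    case 0
    show ?case by (intro exI[of _ 0]) (simp add: center_of_symmetry_def)
  next
    case (Suc n)
    then obtain c where "center_of_symmetry (\<Sum>i<n. closed_segment (a i) (b i)) c" ..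
    from center_of_symmetry_plus[OF this seg] show ?case unfolding sum.lessThan_Suc by (rule exI)
  qed
  then show ?thesis using Z by simp
qed

end

theory Submission
  imports Defs
begin

text \<open>Write the tiles as translates of a zonotope generated by segments \<open>[-v\<^sub>i, v\<^sub>i]\<close>. If \<open>m\<close> is normal to a
  hyperplane spanned by generators, the neighbour across the corresponding facet is the translate by
  \<open>t\<^sub>m = 2 \<Sum>\<^sub>i sgn (m \<bullet> v\<^sub>i) v\<^sub>i\<close>, and moving along a generic segment shows that the vectors \<open>t\<^sub>m\<close>
  generate the lattice. A spanned subspace of codimension two lies in at most three spanned
  hyperplanes: otherwise, for two normals \<open>m, n\<close> consecutive in the pencil, the vector
  \<open>(t\<^sub>m - t\<^sub>n) / 2\<close> has zero coefficients on a spanning set of generators, so it is interior to the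
  zonotope and two tiles overlap. Hence \<open>t\<^sub>m = t\<^sub>p + t\<^sub>q\<close> whenever \<open>m\<close> is a positive combination of
  normals \<open>p, q\<close> in such a pencil. Fix a basis of the space consisting of generators. By induction
  on the number of basis vectors not orthogonal to \<open>m\<close>, every \<open>t\<^sub>m\<close> is an integer combination of the
  \<open>d\<close> vectors belonging to the hyperplanes spanned by all but one basis vector.\<close>

section \<open>Integer spans and linear functionals\<close>

text \<open>The set required in \<open>lattice_basis\<close>, kept apart from independence, which
  for the chosen generators comes out only at the end.\<close>

definition int_span :: "'a::real_vector set \<Rightarrow> 'a set" where
  "int_span B = {\<Sum>b\<in>B. of_int (k b) *\<^sub>R b | k :: 'a \<Rightarrow> int. True}"

lemma int_span_add:
  assumes "x \<in> int_span B" "y \<in> int_span B"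
  shows "x + y \<in> int_span B"
proof -
  obtain k l :: "'a \<Rightarrow> int" where "x = (\<Sum>b\<in>B. of_int (k b) *\<^sub>R b)" "y = (\<Sum>b\<in>B. of_int (l b) *\<^sub>R b)"
    using assms unfolding int_span_def by blast
  then have "x + y = (\<Sum>b\<in>B. of_int (k b + l b) *\<^sub>R b)"
    by (simp add: sum.distrib scaleR_add_left)
  then show ?thesis unfolding int_span_def by (intro CollectI exI[of _ "\<lambda>b. k b + l b"]) simp
qed

lemma int_span_uminus:
  assumes "x \<in> int_span B" shows "- x \<in> int_span B"
proof -
  obtain k :: "'a \<Rightarrow> int" where "x = (\<Sum>b\<in>B. of_int (k b) *\<^sub>R b)"
    using assms unfolding int_span_def by blast
  then show ?thesis unfolding int_span_def by (intro CollectI exI[of _ "\<lambda>b. - k b"]) (simp add: sum_negf)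
qed

lemma int_span_zero: "0 \<in> int_span B"
  unfolding int_span_def by (intro CollectI exI[of _ "\<lambda>_. 0"]) simp

lemma int_span_base:
  assumes "finite B" "b \<in> B" shows "b \<in> int_span B"
proof -
  have "(\<Sum>x\<in>B. of_int (if x = b then 1 else 0) *\<^sub>R x) = (\<Sum>x\<in>B. if x = b then x else 0)"
    by (intro sum.cong) auto
  also have "\<dots> = b" using assms by (simp add: sum.delta)
  finally show ?thesis unfolding int_span_def by (intro CollectI exI[of _ "\<lambda>x. if x = b then 1 else 0"]) simp
qed

lemma int_span_subset_span: "int_span B \<subseteq> span B"
  unfolding int_span_def by (auto intro: span_sum span_scale span_base)

lemma closed_under_int_span:
  assumes "finite B" and step: "\<And>b s. b \<in> B \<Longrightarrow> s \<in> S \<Longrightarrow> s + b \<in> S \<and> s - b \<in> S"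
    and "s \<in> S" "d \<in> int_span B"
  shows "s + d \<in> S"
proof -
  have mult: "s + of_int k *\<^sub>R b \<in> S" if "b \<in> B" "s \<in> S" for b s and k :: int
  proof -
    have "s + of_nat n *\<^sub>R b \<in> S \<and> s - of_nat n *\<^sub>R b \<in> S" for n
    proof (induction n)
      case (Suc n)
      have "s + of_nat (Suc n) *\<^sub>R b = (s + of_nat n *\<^sub>R b) + b"
        "s - of_nat (Suc n) *\<^sub>R b = (s - of_nat n *\<^sub>R b) - b" by (simp_all add: algebra_simps)
      then show ?case using step[OF \<open>b \<in> B\<close>] Suc by metis
    qed (use that in simp)
    then show ?thesis by (cases k rule: int_cases2) auto
  qed
  obtain k :: "'a \<Rightarrow> int" where d: "d = (\<Sum>b\<in>B. of_int (k b) *\<^sub>R b)"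
    using assms(4) unfolding int_span_def by blast
  have "s + (\<Sum>b\<in>A. of_int (k b) *\<^sub>R b) \<in> S" if "finite A" "A \<subseteq> B" for A
    using that
  proof (induction A)
    case (insert a A)
    then have "(s + (\<Sum>b\<in>A. of_int (k b) *\<^sub>R b)) + of_int (k a) *\<^sub>R a \<in> S" by (intro mult) auto
    then show ?case using insert by (simp add: algebra_simps)
  qed (use assms in simp)
  then show ?thesis using assms(1) d by blast
qed

text \<open>The component \<open>z\<close> of \<open>b\<close> orthogonal to the span works, since
  \<open>z \<bullet> b = z \<bullet> z\<close>.\<close>

lemma orthogonal_functional_exists:
  fixes b :: "'a::euclidean_space"
  assumes "b \<notin> span A"
  shows "\<exists>e. e \<bullet> b \<noteq> 0 \<and> (\<forall>x\<in>A. e \<bullet> x = 0)"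
proof -
  obtain y z where yz: "y \<in> span A" "\<And>w. w \<in> span A \<Longrightarrow> orthogonal z w" "b = y + z"
    using orthogonal_subspace_decomp_exists[of A b] by blast
  have "z \<bullet> y = 0" using yz by (simp add: orthogonal_def)
  then have "z \<bullet> b = z \<bullet> z" by (simp add: yz(3) inner_add_right)
  moreover have "z \<noteq> 0" using yz assms by auto
  ultimately show ?thesis using yz(2) span_base by (intro exI[of _ z]) (auto simp: orthogonal_def)
qed

text \<open>Pairing with \<open>e\<close> isolates the coefficient of \<open>b\<close>.\<close>

lemma orthogonal_imp_in_span_remove:
  fixes e :: "'a::euclidean_space"
  assumes "x \<in> span B" "b \<in> B" "e \<bullet> b \<noteq> 0" "\<forall>y\<in>B - {b}. e \<bullet> y = 0" "e \<bullet> x = 0"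
  shows "x \<in> span (B - {b})"
proof -
  have "x \<in> span (insert b (B - {b}))" using assms by (simp add: insert_absorb)
  then obtain k where k: "x - k *\<^sub>R b \<in> span (B - {b})" using span_breakdown_eq by blast
  then have "e \<bullet> (x - k *\<^sub>R b) = 0"
    using orthogonal_to_span[of "x - k *\<^sub>R b" "B - {b}" e] assms(4) by (auto simp: orthogonal_def)
  then have "k = 0" using assms by (simp add: inner_diff_right)
  then show ?thesis using k by simp
qed

section \<open>Zonotopes\<close>

text \<open>Minkowski sum of the segments from \<open>- v i\<close> to \<open>v i\<close>, in
  coefficients. Indexing by a family admits zero and repeated generators.\<close>

definition zono :: "'i set \<Rightarrow> ('i \<Rightarrow> 'a::euclidean_space) \<Rightarrow> 'a set" where
  "zono I v = {\<Sum>i\<in>I. c i *\<^sub>R v i | c. \<forall>i\<in>I. \<bar>c i\<bar> \<le> 1}"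

text \<open>For spanning generators these are the normals of the facets of the zonotope.\<close>

definition facet_normal :: "'i set \<Rightarrow> ('i \<Rightarrow> 'a::euclidean_space) \<Rightarrow> 'a \<Rightarrow> bool" where
  "facet_normal I v m \<longleftrightarrow> m \<noteq> 0 \<and> {x. m \<bullet> x = 0} \<subseteq> span (v ` {i\<in>I. m \<bullet> v i = 0})"

text \<open>Twice the center of the face on which \<open>m\<close> is maximal.\<close>

definition facet_step :: "'i set \<Rightarrow> ('i \<Rightarrow> 'a::euclidean_space) \<Rightarrow> 'a \<Rightarrow> 'a" where
  "facet_step I v m = 2 *\<^sub>R (\<Sum>i\<in>I. sgn (m \<bullet> v i) *\<^sub>R v i)"

lemma zonoI: "\<forall>i\<in>I. \<bar>c i\<bar> \<le> 1 \<Longrightarrow> (\<Sum>i\<in>I. c i *\<^sub>R v i) \<in> zono I v"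
  unfolding zono_def by blast

lemma zonoE:
  assumes "x \<in> zono I v"
  obtains c where "x = (\<Sum>i\<in>I. c i *\<^sub>R v i)" "\<forall>i\<in>I. \<bar>c i\<bar> \<le> 1"
  using assms unfolding zono_def by blast

lemma zono_uminus: "x \<in> zono I v \<Longrightarrow> - x \<in> zono I v"
proof (erule zonoE)
  fix c assume "x = (\<Sum>i\<in>I. c i *\<^sub>R v i)" "\<forall>i\<in>I. \<bar>c i\<bar> \<le> 1"
  then show ?thesis using zonoI[of I "\<lambda>i. - c i" v] by (simp add: sum_negf)
qed

lemma zero_in_zono: "0 \<in> zono I v"
  using zonoI[of I "\<lambda>_. 0" v] by simp

lemma sgn_sum_in_zono: "(\<Sum>i\<in>I. sgn (m \<bullet> v i) *\<^sub>R v i) \<in> zono I v"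
  by (intro zonoI) (auto simp: sgn_if)

lemma convex_zono: "convex (zono I v)"
proof (rule convexI)
  fix x y and p q :: real
  assume xy: "x \<in> zono I v" "y \<in> zono I v" and pq: "0 \<le> p" "0 \<le> q" "p + q = 1"
  obtain c where c: "x = (\<Sum>i\<in>I. c i *\<^sub>R v i)" "\<forall>i\<in>I. \<bar>c i\<bar> \<le> 1" using xy(1) by (blast elim: zonoE)
  obtain d where d: "y = (\<Sum>i\<in>I. d i *\<^sub>R v i)" "\<forall>i\<in>I. \<bar>d i\<bar> \<le> 1" using xy(2) by (blast elim: zonoE)
  have eq: "p *\<^sub>R x + q *\<^sub>R y = (\<Sum>i\<in>I. (p * c i + q * d i) *\<^sub>R v i)"
    by (simp add: c d scaleR_sum_right sum.distrib algebra_simps)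
  show "p *\<^sub>R x + q *\<^sub>R y \<in> zono I v"
    unfolding eq
  proof (rule zonoI, rule ballI)
    fix i assume i: "i \<in> I"
    have "\<bar>p * c i + q * d i\<bar> \<le> p * \<bar>c i\<bar> + q * \<bar>d i\<bar>"
      using abs_triangle_ineq[of "p * c i" "q * d i"] pq by (simp add: abs_mult)
    also have "\<dots> \<le> p * 1 + q * 1"
      using c(2) d(2) i pq by (intro add_mono mult_left_mono) auto
    finally show "\<bar>p * c i + q * d i\<bar> \<le> 1" using pq by simp
  qed
qed

text \<open>The terms \<open>g i\<close> are nonnegative, and maximality makes their sum at most 0,
  so each vanishes.\<close>

lemma zono_support:
  assumes "finite I" and c: "\<forall>i\<in>I. \<bar>c i\<bar> \<le> 1"
    and sup: "\<forall>y\<in>zono I v. a \<bullet> y \<le> a \<bullet> (\<Sum>i\<in>I. c i *\<^sub>R v i)"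
    and i: "i \<in> I" "a \<bullet> v i \<noteq> 0"
  shows "c i = sgn (a \<bullet> v i)"
proof -
  define g where "g = (\<lambda>i. (sgn (a \<bullet> v i) - c i) * (a \<bullet> v i))"
  have nn: "g j \<ge> 0" if "j \<in> I" for j
    using bspec[OF c that] unfolding g_def by (cases "a \<bullet> v j" "0::real" rule: linorder_cases)
      (auto simp: mult_nonpos_nonpos)
  have "sum g I = a \<bullet> (\<Sum>i\<in>I. sgn (a \<bullet> v i) *\<^sub>R v i) - a \<bullet> (\<Sum>i\<in>I. c i *\<^sub>R v i)"
    by (simp add: g_def inner_sum_right sum_subtractf left_diff_distrib)
  also have "\<dots> \<le> 0" using bspec[OF sup sgn_sum_in_zono[of a v I]] by simp
  finally have "sum g I = 0" using sum_nonneg[of I g] nn by force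
  then have "g i = 0" using sum_nonneg_eq_0_iff[OF \<open>finite I\<close>, of g] nn i by simp
  then show ?thesis using i by (simp add: g_def)
qed

text \<open>If the interior is empty, \<open>P\<close> lies in a hyperplane, whose normal serves;
  otherwise interior and relative interior agree.\<close>

lemma convex_supporting_hyperplane:
  fixes P :: "'a::euclidean_space set"
  assumes "convex P" "x \<in> P" "x \<notin> interior P"
  obtains a where "a \<noteq> 0" "\<forall>y\<in>P. a \<bullet> y \<le> a \<bullet> x"
proof (cases "interior P = {}")
  case True
  then obtain a b where "a \<noteq> 0" and ab: "P \<subseteq> {x. a \<bullet> x = b}"
    using empty_interior_subset_hyperplane[OF \<open>convex P\<close>] by blast
  have "a \<bullet> y \<le> a \<bullet> x" if "y \<in> P" for y
    using subsetD[OF ab that] subsetD[OF ab \<open>x \<in> P\<close>] by simp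
  with \<open>a \<noteq> 0\<close> that[of a] show ?thesis by blast
next
  case False
  then have "x \<notin> rel_interior P" using assms rel_interior_nonempty_interior[of P] by simp
  then obtain a where "a \<noteq> 0" "\<forall>y\<in>P. a \<bullet> x \<le> a \<bullet> y"
    using supporting_hyperplane_rel_boundary[OF \<open>convex P\<close> \<open>x \<in> P\<close>] by metis
  with that[of "- a"] show ?thesis by simp
qed

lemma zono_boundary:
  assumes "finite I" and c: "\<forall>i\<in>I. \<bar>c i\<bar> \<le> 1"
    and "(\<Sum>i\<in>I. c i *\<^sub>R v i) \<notin> interior (zono I v)"
  shows "\<exists>m. m \<noteq> 0 \<and> (\<forall>i\<in>I. m \<bullet> v i \<noteq> 0 \<longrightarrow> c i = sgn (m \<bullet> v i))"
proof -
  obtain m where "m \<noteq> 0" "\<forall>y\<in>zono I v. m \<bullet> y \<le> m \<bullet> (\<Sum>i\<in>I. c i *\<^sub>R v i)"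
    using convex_supporting_hyperplane[OF convex_zono zonoI[OF c] assms(3)] by blast
  moreover from zono_support[OF \<open>finite I\<close> c this(2)]
  have "\<forall>i\<in>I. m \<bullet> v i \<noteq> 0 \<longrightarrow> c i = sgn (m \<bullet> v i)" by blast
  ultimately show ?thesis by blast
qed

lemma orthogonal_spanning_imp_zero:
  assumes "span A = UNIV" "\<And>x. x \<in> A \<Longrightarrow> m \<bullet> x = 0"
  shows "m = (0::'a::euclidean_space)"
proof -
  have "orthogonal m m"
    using orthogonal_to_span[of m A m] assms by (auto simp: orthogonal_def)
  then show ?thesis by (simp add: orthogonal_def)
qed

text \<open>A functional supporting at a boundary point forces the coefficients of generators not
  orthogonal to it to be 1 or -1. It would thus be orthogonal to the remaining generators, which
  span.\<close>

lemma zono_interior: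
  assumes "finite I" and c: "\<forall>i\<in>I. \<bar>c i\<bar> \<le> 1"
    and sp: "span (v ` {i\<in>I. \<bar>c i\<bar> < 1}) = UNIV"
  shows "(\<Sum>i\<in>I. c i *\<^sub>R v i) \<in> interior (zono I v)"
proof (rule ccontr)
  assume "\<not> ?thesis"
  then obtain m where m: "m \<noteq> 0" "\<forall>i\<in>I. m \<bullet> v i \<noteq> 0 \<longrightarrow> c i = sgn (m \<bullet> v i)"
    using zono_boundary[where v = v, OF assms(1) c] by blast
  have "m \<bullet> x = 0" if "x \<in> v ` {i\<in>I. \<bar>c i\<bar> < 1}" for x
    using that m(2) by (fastforce simp: sgn_if split: if_splits)
  then show False using orthogonal_spanning_imp_zero[OF sp] m(1) by blast
qed

section \<open>Facet normals and their steps\<close>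

lemma facet_step_uminus: "facet_step I v (- m) = - facet_step I v m"
  by (simp add: facet_step_def sum_negf)

lemma facet_step_scale:
  "facet_step I v (r *\<^sub>R m) = sgn r *\<^sub>R facet_step I v m"
  by (simp add: facet_step_def scaleR_sum_right sgn_mult ac_simps)

lemma facet_normal_uminus: "facet_normal I v (- m) \<longleftrightarrow> facet_normal I v m"
  by (simp add: facet_normal_def)

text \<open>After removing from \<open>a\<close> its component along \<open>m\<close>, the remainder
  \<open>w\<close> lies in the hyperplane, hence in the span; it is orthogonal to both
  \<open>a\<close> and \<open>m\<close> and thus to itself.\<close>

lemma hyperplane_normal_unique:
  assumes "{x. m \<bullet> x = 0} \<subseteq> span A" "\<And>x. x \<in> A \<Longrightarrow> a \<bullet> x = 0" "m \<noteq> (0::'a::euclidean_space)"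
  obtains r where "a = r *\<^sub>R m"
proof -
  define r where "r = (a \<bullet> m) / (m \<bullet> m)"
  define w where "w = a - r *\<^sub>R m"
  have mw: "m \<bullet> w = 0" using assms(3) by (simp add: w_def r_def inner_diff_right inner_commute)
  then have "w \<in> span A" using assms(1) by blast
  then have "a \<bullet> w = 0"
    using orthogonal_to_span[of w A a] assms(2) by (auto simp: orthogonal_def)
  with mw have "w \<bullet> w = 0" by (simp add: w_def inner_diff_left)
  then have "a = r *\<^sub>R m" by (simp add: w_def)
  then show ?thesis using that by blast
qed

text \<open>\<open>p\<close> and \<open>q\<close> cut out a subspace of codimension two spanned by
  generators; adding \<open>v k\<close> gives the hyperplane normal to \<open>p\<close>.\<close>

lemma facet_normalI:
  assumes k: "k \<in> I" "p \<bullet> v k = 0" "q \<bullet> v k \<noteq> 0" and "p \<noteq> 0"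
    and sub: "{x. p \<bullet> x = 0 \<and> q \<bullet> x = 0} \<subseteq> span (v ` {i\<in>I. p \<bullet> v i = 0 \<and> q \<bullet> v i = 0})"
  shows "facet_normal I v p"
  unfolding facet_normal_def
proof (intro conjI subsetI)
  fix x assume "x \<in> {x. p \<bullet> x = 0}"
  define r where "r = (q \<bullet> x) / (q \<bullet> v k)"
  have "x - r *\<^sub>R v k \<in> {x. p \<bullet> x = 0 \<and> q \<bullet> x = 0}"
    using k \<open>x \<in> _\<close> by (simp add: r_def inner_diff_right)
  then have "x - r *\<^sub>R v k \<in> span (v ` {i\<in>I. p \<bullet> v i = 0})"
    using sub span_mono[of "v ` {i\<in>I. p \<bullet> v i = 0 \<and> q \<bullet> v i = 0}" "v ` {i\<in>I. p \<bullet> v i = 0}"] by blast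
  moreover have "r *\<^sub>R v k \<in> span (v ` {i\<in>I. p \<bullet> v i = 0})"
    using k by (intro span_scale span_base) auto
  ultimately show "x \<in> span (v ` {i\<in>I. p \<bullet> v i = 0})"
    using span_add by fastforce
qed fact

text \<open>The segment parameter \<open>u\<close> in [0, 1] corresponds to the coefficient
  \<open>2 * u - 1\<close> in [-1, 1].\<close>

lemma segment_sum_eq_zono:
  fixes a b :: "'i \<Rightarrow> 'a::euclidean_space"
  assumes "finite I"
  shows "(\<Sum>i\<in>I. closed_segment (a i) (b i)) =
    (+) (\<Sum>i\<in>I. midpoint (a i) (b i)) ` zono I (\<lambda>i. (1/2) *\<^sub>R (b i - a i))" (is "?L = (+) ?c ` ?R")
proof (intro set_eqI iffI)
  fix x assume "x \<in> ?L"
  then obtain s where s: "x = sum s I" "\<And>i. i \<in> I \<Longrightarrow> s i \<in> closed_segment (a i) (b i)"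
    using set_sum_alt[OF assms, of "\<lambda>i. closed_segment (a i) (b i)"] by auto
  then have "\<forall>i. \<exists>u. i \<in> I \<longrightarrow> 0 \<le> u \<and> u \<le> 1 \<and> s i = (1 - u) *\<^sub>R a i + u *\<^sub>R b i"
    by (auto simp: in_segment)
  then obtain u where u: "\<And>i. i \<in> I \<Longrightarrow> 0 \<le> u i \<and> u i \<le> 1 \<and> s i = (1 - u i) *\<^sub>R a i + u i *\<^sub>R b i"
    by metis
  have "s i = midpoint (a i) (b i) + (2 * u i - 1) *\<^sub>R (1/2) *\<^sub>R (b i - a i)" if "i \<in> I" for i
  proof -
    have "s i = (1 - u i) *\<^sub>R a i + u i *\<^sub>R b i" using u[OF that] by blast
    moreover have "2 *\<^sub>R \<dots> = 2 *\<^sub>R (midpoint (a i) (b i) + (2 * u i - 1) *\<^sub>R (1/2) *\<^sub>R (b i - a i))"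
      unfolding scaleR_add_right by (simp add: midpoint_def algebra_simps scaleR_2)
    ultimately show ?thesis by simp
  qed
  then have "x = ?c + (\<Sum>i\<in>I. (2 * u i - 1) *\<^sub>R (1/2) *\<^sub>R (b i - a i))"
    unfolding s(1) sum.distrib[symmetric] by (intro sum.cong) auto
  moreover have "(\<Sum>i\<in>I. (2 * u i - 1) *\<^sub>R (1/2) *\<^sub>R (b i - a i)) \<in> ?R"
    using u by (intro zonoI) (auto simp: abs_le_iff)
  ultimately show "x \<in> (+) ?c ` ?R" by blast
next
  fix x assume "x \<in> (+) ?c ` ?R"
  then obtain y where y: "y \<in> ?R" "x = ?c + y" by blast
  obtain c where c: "y = (\<Sum>i\<in>I. c i *\<^sub>R (1/2) *\<^sub>R (b i - a i))" "\<forall>i\<in>I. \<bar>c i\<bar> \<le> 1"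
    using y(1) by (auto elim!: zonoE)
  have seg: "midpoint (a i) (b i) + c i *\<^sub>R (1/2) *\<^sub>R (b i - a i) \<in> closed_segment (a i) (b i)" if "i \<in> I" for i
  proof -
    define u where "u = (1 + c i) / 2"
    have c_eq: "c i = 2 * u - 1" by (simp add: u_def field_simps)
    have "2 *\<^sub>R (midpoint (a i) (b i) + c i *\<^sub>R (1/2) *\<^sub>R (b i - a i)) = 2 *\<^sub>R ((1 - u) *\<^sub>R a i + u *\<^sub>R b i)"
      unfolding scaleR_add_right c_eq by (simp add: midpoint_def algebra_simps scaleR_2)
    then have "midpoint (a i) (b i) + c i *\<^sub>R (1/2) *\<^sub>R (b i - a i) = (1 - u) *\<^sub>R a i + u *\<^sub>R b i"
      by simp
    moreover have "0 \<le> u" "u \<le> 1" using bspec[OF c(2) that] by (auto simp: u_def abs_le_iff)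
    ultimately show ?thesis unfolding in_segment by blast
  qed
  have "x = (\<Sum>i\<in>I. midpoint (a i) (b i) + c i *\<^sub>R (1/2) *\<^sub>R (b i - a i))"
    by (simp add: y c sum.distrib)
  then show "x \<in> ?L" using seg unfolding set_sum_alt[OF assms] by blast
qed

lemma mem_translation_iff: "x \<in> (+) s ` A \<longleftrightarrow> x - s \<in> (A :: 'a::ab_group_add set)"
  by (force simp: image_iff algebra_simps)

section \<open>Face-to-face tilings by translates of a zonotope\<close>

text \<open>\<open>S\<close> is the set of tile centers. Packing compares positions rather than
  tiles; exchanging \<open>s\<close> and \<open>s'\<close> in \<open>faces\<close> gives the face
  property for the other tile.\<close>

locale zonotopal_tiling =
  fixes I :: "'i set" and v :: "'i \<Rightarrow> 'a::euclidean_space" and S :: "'a set"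
  assumes fin: "finite I" and spanning: "span (v ` I) = UNIV"
    and polytope_zono: "polytope (zono I v)"
    and covering: "\<exists>s\<in>S. x - s \<in> zono I v"
    and packing: "s \<in> S \<Longrightarrow> s' \<in> S \<Longrightarrow> x - s \<in> interior (zono I v) \<Longrightarrow>
      x - s' \<in> interior (zono I v) \<Longrightarrow> s = s'"
    and faces: "s \<in> S \<Longrightarrow> s' \<in> S \<Longrightarrow>
      ((+) s ` zono I v \<inter> (+) s' ` zono I v) face_of (+) s ` zono I v"
begin

abbreviation "Z \<equiv> zono I v"

section \<open>Separation and local finiteness of the tiles\<close>

lemma zero_interior: "0 \<in> interior Z"
  using zono_interior[where v = v and c = "\<lambda>_. 0", OF fin] spanning by simp

lemma compact_Z: "compact Z"
  using polytope_zono polytope_imp_compact by blast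

lemma closure_interior_tile: "closure ((+) s ` interior Z) = (+) s ` Z"
  using convex_closure_interior[OF convex_zono[of I v]] zero_interior compact_Z
  by (simp add: closure_translation compact_imp_closed closure_closed) (metis empty_iff)

lemma interiors_disjoint:
  assumes "s \<in> S" "s' \<in> S" "s \<noteq> s'"
  shows "(+) s ` interior Z \<inter> (+) s' ` interior Z = {}"
  unfolding disjoint_iff mem_translation_iff using packing assms by blast

text \<open>An open set disjoint from another set is disjoint from its closure, and a tile is the
  closure of its interior.\<close>

lemma packing_closed:
  assumes "s \<in> S" "s' \<in> S" "x - s \<in> interior Z" "x - s' \<in> Z"
  shows "s = s'"
proof (rule ccontr)
  assume "s \<noteq> s'"
  then have "(+) s ` interior Z \<inter> (+) s' ` interior Z = {}"
    using interiors_disjoint assms by blast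
  then have "(+) s ` interior Z \<inter> (+) s' ` Z = {}"
    using open_Int_closure_eq_empty[of "(+) s ` interior Z" "(+) s' ` interior Z"]
    unfolding closure_interior_tile by (simp add: open_translation)
  then show False using assms by (auto simp: mem_translation_iff disjoint_iff)
qed

text \<open>If the ball of radius \<open>r\<close> around 0 lies in the interior of
  \<open>Z\<close>, a center \<open>s'\<close> closer to \<open>s\<close> than \<open>r\<close> is
  interior to both tiles.\<close>

lemma separated: "\<exists>r>0. \<forall>s\<in>S. \<forall>s'\<in>S. dist s s' < r \<longrightarrow> s = s'"
proof -
  obtain r where r: "r > 0" "ball 0 r \<subseteq> interior Z"
    using zero_interior open_interior open_contains_ball by blast
  have "s = s'" if "s \<in> S" "s' \<in> S" "dist s s' < r" for s s'
    using packing[OF that(1,2), of s'] zero_interior r that(3)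
    by (auto simp: subset_iff dist_norm norm_minus_commute)
  with r show ?thesis by blast
qed

text \<open>An accumulation point would bring two distinct centers closer than the separation
  radius.\<close>

lemma finite_tiles: "finite (S \<inter> cball x R)"
proof (rule ccontr)
  assume inf: "infinite (S \<inter> cball x R)"
  obtain r where r: "r > 0" "\<forall>s\<in>S. \<forall>s'\<in>S. dist s s' < r \<longrightarrow> s = s'" using separated by blast
  obtain y where "y islimpt (S \<inter> cball x R)"
    using compact_cball[of x R] inf unfolding compact_eq_Bolzano_Weierstrass by blast
  then have "infinite (S \<inter> cball x R \<inter> ball y (r / 2))"
    using r(1) islimpt_eq_infinite_ball by (metis half_gt_zero)
  then obtain p q where pq: "p \<in> S" "q \<in> S" "p \<noteq> q" "p \<in> ball y (r / 2)" "q \<in> ball y (r / 2)"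
    using infinite_arbitrarily_large[of "S \<inter> cball x R \<inter> ball y (r / 2)" 2] by (auto simp: card_2_iff)
  then have "dist p q < r" using dist_triangle_half_r[of y p r q] by (simp add: dist_commute)
  then show False using r(2) pq by blast
qed

lemma countable_tiles: "countable S"
proof -
  have "S \<subseteq> (\<Union>n::nat. S \<inter> cball 0 (real n))"
    using real_arch_simple by (fastforce simp: dist_norm)
  moreover have "countable (\<Union>n::nat. S \<inter> cball 0 (real n))"
    using finite_tiles countable_finite by blast
  ultimately show ?thesis using countable_subset by blast
qed

text \<open>A tile with a point at distance below 1 from \<open>x\<close> has its center within
  \<open>1 + M\<close> of \<open>x\<close>. Finitely many tiles with such centers miss
  \<open>x\<close>; their union is closed, so a small ball avoids it.\<close>

lemma locally_finite:
  obtains e where "e > 0" "\<And>s y. s \<in> S \<Longrightarrow> dist x y < e \<Longrightarrow> y - s \<in> Z \<Longrightarrow> x - s \<in> Z"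
proof -
  obtain M where M: "\<And>z. z \<in> Z \<Longrightarrow> norm z \<le> M"
    using compact_imp_bounded[OF compact_Z] bounded_iff by blast
  define N where "N = {s \<in> S \<inter> cball x (1 + M). x - s \<notin> Z}"
  have "finite N" unfolding N_def using finite_tiles[of x "1 + M"] by (rule rev_finite_subset) blast
  then have "closed (\<Union>s\<in>N. (+) s ` Z)"
    using compact_Z by (intro closed_UN) (auto intro: closed_translation compact_imp_closed)
  moreover have "x \<notin> (\<Union>s\<in>N. (+) s ` Z)"
    by (simp add: N_def mem_translation_iff)
  ultimately obtain e where e: "e > 0" "ball x e \<inter> (\<Union>s\<in>N. (+) s ` Z) = {}"
    by (metis closed_def open_contains_ball ComplI disjoint_eq_subset_Compl)
  show ?thesis
  proof (rule that[of "min e 1"])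
    fix s y assume s: "s \<in> S" and y: "dist x y < min e 1" "y - s \<in> Z"
    have "norm (x - s) \<le> norm (x - y) + norm (y - s)"
      using norm_triangle_ineq[of "x - y" "y - s"] by simp
    then have "s \<in> cball x (1 + M)" using M[OF y(2)] y(1) by (simp add: dist_norm)
    moreover have "s \<notin> N" using e(2) y by (auto simp: disjoint_iff mem_translation_iff)
    ultimately show "x - s \<in> Z" using s by (simp add: N_def)
  qed (use e in simp)
qed

lemma closed_tiles_Union:
  assumes "L \<subseteq> S"
  shows "closed {x. \<exists>l\<in>L. x - l \<in> Z}"
  unfolding closed_def open_contains_ball
proof
  fix x assume x: "x \<in> - {x. \<exists>l\<in>L. x - l \<in> Z}"
  obtain e where e: "e > 0" "\<And>s y. s \<in> S \<Longrightarrow> dist x y < e \<Longrightarrow> y - s \<in> Z \<Longrightarrow> x - s \<in> Z"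
    using locally_finite[of x] by blast
  then have "ball x e \<subseteq> - {x. \<exists>l\<in>L. x - l \<in> Z}" using x assms by fastforce
  then show "\<exists>e>0. ball x e \<subseteq> - {x. \<exists>l\<in>L. x - l \<in> Z}" using e(1) by blast
qed

section \<open>Faces of the zonotope in a given direction\<close>

lemma facet_step_pos:
  assumes "m \<noteq> 0"
  shows "m \<bullet> facet_step I v m > 0"
proof -
  obtain i where i: "i \<in> I" "m \<bullet> v i \<noteq> 0"
    using orthogonal_spanning_imp_zero[OF spanning, of m] assms by blast
  have "0 < (\<Sum>i\<in>I. \<bar>m \<bullet> v i\<bar>)"
    using i by (intro sum_pos2[OF fin i(1)]) auto
  also have "\<dots> = (\<Sum>i\<in>I. sgn (m \<bullet> v i) * (m \<bullet> v i))"
    by (intro sum.cong) (simp_all add: abs_sgn mult.commute)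
  finally show ?thesis by (simp add: facet_step_def inner_sum_right)
qed

text \<open>The face exposed by \<open>m\<close>: the value bounds \<open>m\<close> on
  \<open>Z\<close> by \<open>zono_inner_le\<close> and is attained at half the step.\<close>

definition face_at :: "'a \<Rightarrow> 'a set" where
  "face_at m = {y \<in> Z. m \<bullet> y = m \<bullet> facet_step I v m / 2}"

lemma zono_inner_le:
  assumes "y \<in> Z" shows "m \<bullet> y \<le> m \<bullet> facet_step I v m / 2"
proof -
  obtain c where c: "y = (\<Sum>i\<in>I. c i *\<^sub>R v i)" "\<forall>i\<in>I. \<bar>c i\<bar> \<le> 1"
    using assms by (blast elim: zonoE)
  have "c i * (m \<bullet> v i) \<le> sgn (m \<bullet> v i) * (m \<bullet> v i)" if "i \<in> I" for i
  proof -
    have "c i * (m \<bullet> v i) \<le> \<bar>c i\<bar> * \<bar>m \<bullet> v i\<bar>" by (metis abs_ge_self abs_mult)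
    also have "\<dots> \<le> 1 * \<bar>m \<bullet> v i\<bar>" using bspec[OF c(2) that] by (intro mult_right_mono) auto
    finally show ?thesis by (simp add: abs_sgn mult.commute)
  qed
  then have "m \<bullet> y \<le> (\<Sum>i\<in>I. sgn (m \<bullet> v i) * (m \<bullet> v i))"
    unfolding c(1) by (simp add: inner_sum_right sum_mono)
  then show ?thesis by (simp add: facet_step_def inner_sum_right)
qed

lemma face_atI:
  assumes c: "\<forall>i\<in>I. \<bar>c i\<bar> \<le> 1"
    "\<forall>i\<in>I. m \<bullet> v i \<noteq> 0 \<longrightarrow> c i = sgn (m \<bullet> v i)"
  shows "(\<Sum>i\<in>I. c i *\<^sub>R v i) \<in> face_at m"
proof -
  have "m \<bullet> (\<Sum>i\<in>I. c i *\<^sub>R v i) = (\<Sum>i\<in>I. sgn (m \<bullet> v i) * (m \<bullet> v i))"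
    unfolding inner_sum_right inner_scaleR_right using c(2) by (intro sum.cong) auto
  then show ?thesis using zonoI[OF c(1)] by (simp add: face_at_def facet_step_def inner_sum_right)
qed

lemma face_atE:
  assumes "y \<in> face_at m"
  obtains c where "y = (\<Sum>i\<in>I. c i *\<^sub>R v i)" "\<forall>i\<in>I. \<bar>c i\<bar> \<le> 1"
    "\<forall>i\<in>I. m \<bullet> v i \<noteq> 0 \<longrightarrow> c i = sgn (m \<bullet> v i)"
proof -
  have y: "y \<in> Z" "m \<bullet> y = m \<bullet> facet_step I v m / 2" using assms by (auto simp: face_at_def)
  obtain c where c: "y = (\<Sum>i\<in>I. c i *\<^sub>R v i)" "\<forall>i\<in>I. \<bar>c i\<bar> \<le> 1"
    using y(1) by (blast elim: zonoE)
  have "c i = sgn (m \<bullet> v i)" if "i \<in> I" "m \<bullet> v i \<noteq> 0" for i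
    using zono_support[where v = v and c = c and a = m, OF fin c(2) _ that] zono_inner_le[of _ m] y(2)
    unfolding c(1) by simp
  with c that show ?thesis by blast
qed

text \<open>Half the step is the center of the face: the reflection keeps the forced coefficients
  and negates the free ones.\<close>

lemma face_at_reflect:
  assumes "y \<in> face_at m" shows "facet_step I v m - y \<in> face_at m"
proof -
  obtain c where c: "y = (\<Sum>i\<in>I. c i *\<^sub>R v i)" "\<forall>i\<in>I. \<bar>c i\<bar> \<le> 1"
    "\<forall>i\<in>I. m \<bullet> v i \<noteq> 0 \<longrightarrow> c i = sgn (m \<bullet> v i)"
    using assms by (blast elim: face_atE)
  have "facet_step I v m - y = (\<Sum>i\<in>I. (2 * sgn (m \<bullet> v i) - c i) *\<^sub>R v i)"
    by (simp add: c(1) facet_step_def scaleR_sum_right sum_subtractf scaleR_diff_left)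
  also have "\<dots> \<in> face_at m"
  proof (rule face_atI; intro ballI impI)
    fix i assume i: "i \<in> I"
    show "\<bar>2 * sgn (m \<bullet> v i) - c i\<bar> \<le> 1"
      using bspec[OF c(2) i] c(3) i by (cases "m \<bullet> v i = 0") (auto simp: sgn_if)
    show "2 * sgn (m \<bullet> v i) - c i = sgn (m \<bullet> v i)" if "m \<bullet> v i \<noteq> 0"
      using c(3) i that by simp
  qed
  finally show ?thesis .
qed

text \<open>A tile meeting the relative interior of the facet with normal \<open>m\<close> of the tile at \<open>s\<close>:
  a separating hyperplane shows that it lies on the other side of the facet; the common face then
  contains the whole facet, and comparing centers of symmetry of the facet identifies it.\<close>

lemma facet_neighbour:
  assumes s: "s \<in> S" "s' \<in> S" "s \<noteq> s'" and "m \<noteq> 0"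
    and c: "\<forall>i\<in>I. \<bar>c i\<bar> \<le> 1"
      "\<forall>i\<in>I. m \<bullet> v i \<noteq> 0 \<longrightarrow> c i = sgn (m \<bullet> v i)"
    and free: "{x. m \<bullet> x = 0} \<subseteq> span (v ` {i\<in>I. \<bar>c i\<bar> < 1})"
    and x: "x - s = (\<Sum>i\<in>I. c i *\<^sub>R v i)" "x - s' \<in> Z"
  shows "s' = s + facet_step I v m" and "(+) s ` Z \<inter> (+) s' ` Z = (+) s ` face_at m"
proof -
  define t where "t = facet_step I v m"
  have xface: "x - s \<in> face_at m" unfolding x(1) using c by (rule face_atI)
  then have xZ: "x - s \<in> Z" and xm: "m \<bullet> (x - s) = m \<bullet> t / 2" by (auto simp: face_at_def t_def)
  \<comment> \<open>A functional maximal over \<open>Z\<close> at \<open>x - s\<close> kills the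
    free generators by \<open>zono_support\<close>, hence is a multiple of \<open>m\<close>; its
    value at 0 gives the sign.\<close>
  have parallel: "\<exists>r. a = r *\<^sub>R m \<and> r \<ge> 0" if sup: "\<And>y. y \<in> Z \<Longrightarrow> a \<bullet> y \<le> a \<bullet> (x - s)" for a
  proof -
    have "a \<bullet> w = 0" if "w \<in> v ` {i\<in>I. \<bar>c i\<bar> < 1}" for w
    proof (rule ccontr)
      assume "a \<bullet> w \<noteq> 0"
      obtain i where i: "w = v i" "i \<in> I" "\<bar>c i\<bar> < 1" using \<open>w \<in> _\<close> by blast
      then have "c i = sgn (a \<bullet> v i)"
        using zono_support[where v = v and c = c and a = a, OF fin c(1) _ i(2)] sup i(1) \<open>a \<bullet> w \<noteq> 0\<close>
        by (simp add: x(1))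
      then show False using i \<open>a \<bullet> w \<noteq> 0\<close> by (simp add: sgn_if split: if_splits)
    qed
    then obtain r where r: "a = r *\<^sub>R m" using hyperplane_normal_unique[OF free _ \<open>m \<noteq> 0\<close>] by metis
    have "r * (m \<bullet> t) \<ge> 0"
      using sup[OF zero_in_zono] xm by (simp add: r)
    then have "r \<ge> 0" using facet_step_pos[OF \<open>m \<noteq> 0\<close>] by (simp add: t_def zero_le_mult_iff)
    with r show ?thesis by blast
  qed
  \<comment> \<open>A hyperplane separating the two interiors passes through the common point
    \<open>x\<close>, so it supports the tile at \<open>s\<close> there and is normal to
    \<open>m\<close>.\<close>
  have upper: "m \<bullet> y \<ge> m \<bullet> x" if y: "y - s' \<in> Z" for y
  proof -
    have "(+) s ` interior Z \<inter> (+) s' ` interior Z = {}"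
      using interiors_disjoint s by blast
    moreover have "convex ((+) s ` interior Z)" "convex ((+) s' ` interior Z)"
      by (simp_all add: convex_zono convex_interior)
    ultimately obtain a b where "a \<noteq> 0" and a: "\<forall>x\<in>(+) s ` interior Z. a \<bullet> x \<le> b"
      "\<forall>x\<in>(+) s' ` interior Z. a \<bullet> x \<ge> b"
      using separating_hyperplane_sets[of "(+) s ` interior Z" "(+) s' ` interior Z"] zero_interior
      by blast
    have le: "a \<bullet> y \<le> b" if "y - s \<in> Z" for y
      using closure_minimal[of "(+) s ` interior Z" "{x. a \<bullet> x \<le> b}"] a(1) that
      unfolding closure_interior_tile
      by (auto simp: closed_halfspace_le mem_translation_iff subset_iff)
    have ge: "a \<bullet> y \<ge> b" if "y - s' \<in> Z" for y
      using closure_minimal[of "(+) s' ` interior Z" "{x. a \<bullet> x \<ge> b}"] a(2) that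
      unfolding closure_interior_tile
      by (auto simp: closed_halfspace_ge mem_translation_iff subset_iff)
    have ax: "a \<bullet> x = b" using le[OF xZ] ge[OF x(2)] by simp
    have "a \<bullet> z \<le> a \<bullet> (x - s)" if "z \<in> Z" for z
      using le[of "z + s"] that ax by (simp add: inner_add_right inner_diff_right)
    then obtain r where r: "a = r *\<^sub>R m" "r \<ge> 0" using parallel by blast
    then have "r > 0" using \<open>a \<noteq> 0\<close> by (cases "r = 0") auto
    then show ?thesis using ge[OF y] r mult_le_cancel_left_pos[of r] unfolding ax[symmetric] by simp
  qed
  \<comment> \<open>One inequality reflects \<open>x\<close> in \<open>s'\<close>; the other applies
    \<open>upper\<close> to the lowest point \<open>s' - (1/2) *\<^sub>R t\<close> considered in
    that tile.\<close>
  have shift: "m \<bullet> s' = m \<bullet> s + m \<bullet> t"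
  proof (rule antisym)
    have "- (x - s') \<in> Z" using x(2) zono_uminus by blast
    from zono_inner_le[OF this, of m] show "m \<bullet> s' \<le> m \<bullet> s + m \<bullet> t"
      using xm by (simp add: inner_diff_right t_def)
    have "- (1/2) *\<^sub>R t \<in> Z" using zono_uminus[OF sgn_sum_in_zono[of m v I]]
      by (simp add: t_def facet_step_def)
    then show "m \<bullet> s' \<ge> m \<bullet> s + m \<bullet> t"
      using upper[of "s' - (1/2) *\<^sub>R t"] xm by (simp add: inner_diff_right)
  qed
  \<comment> \<open>The common face is exposed by a functional \<open>a\<close> that is maximal at
    \<open>x\<close>, hence a multiple of \<open>m\<close> and constant on the facet.\<close>
  have face_sub: "(+) s ` face_at m \<subseteq> (+) s' ` Z"
  proof -
    have "polyhedron ((+) s ` Z)" using polytope_zono by (intro polytope_imp_polyhedron) (simp add: polytope_translation_eq)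
    then have "((+) s ` Z \<inter> (+) s' ` Z) exposed_face_of (+) s ` Z"
      using faces[OF s(1,2)] exposed_face_of_polyhedron by blast
    then obtain a b where a: "(+) s ` Z \<subseteq> {x. a \<bullet> x \<le> b}"
      "(+) s ` Z \<inter> (+) s' ` Z = (+) s ` Z \<inter> {x. a \<bullet> x = b}"
      unfolding exposed_face_of_def by blast
    have "x \<in> (+) s ` Z \<inter> (+) s' ` Z" using xZ x(2) by (simp add: mem_translation_iff)
    then have ax: "a \<bullet> x = b" using a(2) by blast
    have "a \<bullet> z \<le> a \<bullet> (x - s)" if "z \<in> Z" for z
      using subsetD[OF a(1), of "s + z"] that ax by (simp add: inner_add_right inner_diff_right)
    then obtain r where r: "a = r *\<^sub>R m" using parallel by blast
    have "s + y \<in> (+) s' ` Z" if "y \<in> face_at m" for y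
    proof -
      have "m \<bullet> (s + y) = m \<bullet> x" using that xm by (simp add: face_at_def t_def algebra_simps)
      then have "a \<bullet> (s + y) = b" using r ax by simp
      then show ?thesis using a(2) that by (auto simp: face_at_def)
    qed
    then show ?thesis by blast
  qed
  define w where "w = s' - s"
  have mw: "m \<bullet> w = m \<bullet> t" using shift by (simp add: w_def inner_diff_right)
  \<comment> \<open>Reflection in the midpoint of \<open>s\<close> and \<open>s'\<close> exchanges
    the two tiles and keeps the plane of the facet, so half of \<open>w\<close> is a center of
    symmetry of the facet.\<close>
  have refl: "w - y \<in> face_at m" if "y \<in> face_at m" for y
  proof -
    have "s + y - s' \<in> Z" using face_sub that by (auto simp: mem_translation_iff image_subset_iff)
    then have "w - y \<in> Z" using zono_uminus by (fastforce simp: w_def algebra_simps)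
    moreover have "m \<bullet> (w - y) = m \<bullet> t / 2"
      using that mw by (simp add: face_at_def inner_diff_right t_def)
    ultimately show ?thesis by (simp add: face_at_def t_def)
  qed
  have symm: "center_of_symmetry (face_at m) ((1/2) *\<^sub>R u)" if "\<And>y. y \<in> face_at m \<Longrightarrow> u - y \<in> face_at m" for u
    using that unfolding center_of_symmetry_def by (auto simp: image_iff) (metis add_diff_cancel_left' diff_add_cancel)
  have "bounded (face_at m)" using compact_imp_bounded[OF compact_Z]
    by (rule bounded_subset) (auto simp: face_at_def)
  then have "(1/2) *\<^sub>R w = (1/2) *\<^sub>R t"
    using center_of_symmetry_unique[OF _ _ symm symm] refl face_at_reflect xface unfolding t_def by blast
  then have "w = t" by simp
  then show s': "s' = s + facet_step I v m" by (simp add: w_def t_def algebra_simps)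
  show "(+) s ` Z \<inter> (+) s' ` Z = (+) s ` face_at m"
  proof
    show "(+) s ` face_at m \<subseteq> (+) s ` Z \<inter> (+) s' ` Z"
      using face_sub by (auto simp: face_at_def)
    show "(+) s ` Z \<inter> (+) s' ` Z \<subseteq> (+) s ` face_at m"
    proof
      fix y assume "y \<in> (+) s ` Z \<inter> (+) s' ` Z"
      then have y: "y - s \<in> Z" "y - s' \<in> Z" by (auto simp: mem_translation_iff)
      have "m \<bullet> (y - s) = m \<bullet> t / 2"
        using upper[OF y(2)] zono_inner_le[OF y(1), of m] xm by (simp add: inner_diff_right t_def)
      then show "y \<in> (+) s ` face_at m" using y by (simp add: mem_translation_iff face_at_def t_def)
    qed
  qed
qed

text \<open>A point \<open>y\<close> just beyond the center \<open>x\<close> of the facet is covered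
  by another tile, which by local finiteness also contains \<open>x\<close>;
  \<open>facet_neighbour\<close> then locates it.\<close>

lemma facet_normal_step:
  assumes "s \<in> S" and m: "facet_normal I v m"
  defines "s' \<equiv> s + facet_step I v m"
  shows "s' \<in> S" "s' \<noteq> s" "(+) s ` Z \<inter> (+) s' ` Z = (+) s ` face_at m"
proof -
  have m0: "m \<noteq> 0" and msp: "{x. m \<bullet> x = 0} \<subseteq> span (v ` {i\<in>I. m \<bullet> v i = 0})"
    using m by (auto simp: facet_normal_def)
  define c where "c i = sgn (m \<bullet> v i)" for i
  define x where "x = s + (\<Sum>i\<in>I. c i *\<^sub>R v i)"
  have c: "\<forall>i\<in>I. \<bar>c i\<bar> \<le> 1" "\<forall>i\<in>I. m \<bullet> v i \<noteq> 0 \<longrightarrow> c i = sgn (m \<bullet> v i)"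
    by (auto simp: c_def sgn_if)
  have "{i\<in>I. \<bar>c i\<bar> < 1} = {i\<in>I. m \<bullet> v i = 0}" by (auto simp: c_def sgn_if split: if_splits)
  then have free: "{x. m \<bullet> x = 0} \<subseteq> span (v ` {i\<in>I. \<bar>c i\<bar> < 1})" using msp by simp
  have xs: "x - s = (\<Sum>i\<in>I. c i *\<^sub>R v i)" by (simp add: x_def)
  have mx: "m \<bullet> (x - s) = m \<bullet> facet_step I v m / 2"
    by (simp add: xs c_def facet_step_def)
  obtain e where e: "e > 0" "\<And>s y. s \<in> S \<Longrightarrow> dist x y < e \<Longrightarrow> y - s \<in> Z \<Longrightarrow> x - s \<in> Z"
    using locally_finite[of x] by blast
  define y where "y = x + (e / (2 * norm m)) *\<^sub>R m"
  have "dist x y < e" using e(1) m0 by (simp add: y_def dist_norm)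
  obtain u where u: "u \<in> S" "y - u \<in> Z" using covering[of y] by blast
  have xu: "x - u \<in> Z" using e(2)[OF u(1) \<open>dist x y < e\<close> u(2)] .
  have "m \<bullet> (y - s) = m \<bullet> (x - s) + e / (2 * norm m) * (m \<bullet> m)"
    by (simp add: y_def inner_add_right inner_diff_right)
  moreover have "e / (2 * norm m) * (m \<bullet> m) > 0" using e(1) m0 by simp
  ultimately have "m \<bullet> (y - s) > m \<bullet> facet_step I v m / 2" using mx by linarith
  then have "y - s \<notin> Z" using zono_inner_le[of "y - s" m] by auto
  then have "s \<noteq> u" using u(2) by blast
  note nb = facet_neighbour[OF \<open>s \<in> S\<close> u(1) this m0 c free xs xu]
  show "s' \<in> S" "s' \<noteq> s" "(+) s ` Z \<inter> (+) s' ` Z = (+) s ` face_at m"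
    using nb u(1) \<open>s \<noteq> u\<close> by (auto simp: s'_def)
qed

text \<open>The hyperplane gives the upper bound. Moving the center of the face along a generator
  orthogonal to \<open>m\<close> stays in the face, and these generators span the
  hyperplane.\<close>

lemma aff_dim_face_at:
  assumes m: "facet_normal I v m"
  shows "aff_dim (face_at m) = int DIM('a) - 1"
proof (rule antisym)
  have m0: "m \<noteq> 0" and msp: "{x. m \<bullet> x = 0} \<subseteq> span (v ` {i\<in>I. m \<bullet> v i = 0})"
    using m by (auto simp: facet_normal_def)
  have "face_at m \<subseteq> {x. m \<bullet> x = m \<bullet> facet_step I v m / 2}" by (auto simp: face_at_def)
  then show "aff_dim (face_at m) \<le> int DIM('a) - 1"
    using aff_dim_subset[of "face_at m" "{x. m \<bullet> x = m \<bullet> facet_step I v m / 2}"]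
    unfolding aff_dim_hyperplane[OF m0] by simp
  define x where "x = (\<Sum>i\<in>I. sgn (m \<bullet> v i) *\<^sub>R v i)"
  have x: "x \<in> face_at m" unfolding x_def by (rule face_atI) (auto simp: sgn_if)
  have xv: "x + v j \<in> face_at m" if "j \<in> I" "m \<bullet> v j = 0" for j
  proof -
    have "(\<Sum>i\<in>I. (sgn (m \<bullet> v i) + (if i = j then 1 else 0)) *\<^sub>R v i) \<in> face_at m"
      using that by (intro face_atI) (auto simp: sgn_if split: if_splits)
    also have "(\<Sum>i\<in>I. (sgn (m \<bullet> v i) + (if i = j then 1 else 0)) *\<^sub>R v i) = x + v j"
      using that fin by (simp add: x_def scaleR_add_left sum.distrib if_distrib[of "\<lambda>r. r *\<^sub>R _"] sum.delta cong: if_cong)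
    finally show ?thesis .
  qed
  let ?F = "(+) (- x) ` face_at m"
  have "0 \<in> ?F" using x by force
  have "v ` {i\<in>I. m \<bullet> v i = 0} \<subseteq> ?F"
  proof
    fix w assume "w \<in> v ` {i\<in>I. m \<bullet> v i = 0}"
    then obtain j where "w = v j" "j \<in> I" "m \<bullet> v j = 0" by blast
    then show "w \<in> ?F" using xv[of j] by (intro image_eqI[of _ _ "x + v j"]) auto
  qed
  then have "{x. m \<bullet> x = 0} \<subseteq> span ?F" using msp span_mono by blast
  then have "dim {x. m \<bullet> x = 0} \<le> dim ?F" using dim_subset[of "{x. m \<bullet> x = 0}" "span ?F"] by simp
  moreover have "dim {x. m \<bullet> x = 0} = DIM('a) - 1" using dim_hyperplane[OF m0] by simp
  moreover have "aff_dim ?F = int (dim ?F)"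
    using aff_dim_zero[of ?F] hull_inc[OF \<open>0 \<in> ?F\<close>] by blast
  moreover have "aff_dim ?F = aff_dim (face_at m)" by (rule aff_dim_translation_eq)
  ultimately show "aff_dim (face_at m) \<ge> int DIM('a) - 1" by linarith
qed

lemma aff_dim_Z: "aff_dim Z = int DIM('a)"
  by (rule aff_dim_nonempty_interior) (use zero_interior in blast)

lemma common_facet:
  assumes "s \<in> S" and m: "facet_normal I v m"
  defines "s' \<equiv> s + facet_step I v m"
  shows "\<exists>F. F facet_of (+) s ` Z \<and> F facet_of (+) s' ` Z"
proof -
  note step = facet_normal_step[OF \<open>s \<in> S\<close> m, folded s'_def]
  let ?F = "(+) s ` Z \<inter> (+) s' ` Z"
  have "aff_dim ?F = int DIM('a) - 1"
    unfolding step(3) using aff_dim_face_at[OF m] by (simp add: aff_dim_translation_eq)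
  moreover from this have "?F \<noteq> {}" using DIM_positive[where 'a = 'a] by auto
  moreover have "?F face_of (+) s ` Z" "?F face_of (+) s' ` Z"
    using faces[OF \<open>s \<in> S\<close> step(1)] faces[OF step(1) \<open>s \<in> S\<close>] by (simp_all add: Int_commute)
  ultimately have "?F facet_of (+) s ` Z" "?F facet_of (+) s' ` Z"
    by (simp_all add: facet_of_def aff_dim_translation_eq aff_dim_Z)
  then show ?thesis by blast
qed

text \<open>If some \<open>v i\<close> lay in none of the three hyperplanes, then \<open>m\<close> and the normal \<open>n\<close> next to it
  in the pencil would have sign vectors differing only on two of at least four hyperplanes, so that the
  tiles at \<open>facet_step I v m\<close> and \<open>facet_step I v n\<close> would overlap.\<close>

lemma pencil_sgn_add:
  assumes "s \<in> S" and m: "facet_normal I v (\<alpha> *\<^sub>R p + \<beta> *\<^sub>R q)" and pos: "\<alpha> > 0" "\<beta> > 0"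
    and j: "j \<in> I" "p \<bullet> v j = 0" "q \<bullet> v j \<noteq> 0"
    and k: "k \<in> I" "q \<bullet> v k = 0" "p \<bullet> v k \<noteq> 0"
    and sub: "{x. p \<bullet> x = 0 \<and> q \<bullet> x = 0} \<subseteq> span (v ` {i\<in>I. p \<bullet> v i = 0 \<and> q \<bullet> v i = 0})"
    and i: "i \<in> I"
  shows "sgn ((\<alpha> *\<^sub>R p + \<beta> *\<^sub>R q) \<bullet> v i) = sgn (p \<bullet> v i) + sgn (q \<bullet> v i)"
proof (rule ccontr)
  define m where "m = \<alpha> *\<^sub>R p + \<beta> *\<^sub>R q"
  have mv: "m \<bullet> x = \<alpha> * (p \<bullet> x) + \<beta> * (q \<bullet> x)" for x by (simp add: m_def inner_add_left)
  assume contra: "\<not> ?thesis"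
  \<comment> \<open>As \<open>\<alpha>\<close> and \<open>\<beta>\<close> are positive, the sign
    identity holds whenever \<open>p\<close>, \<open>q\<close> or \<open>m\<close> is orthogonal to
    \<open>v i\<close>.\<close>
  have "p \<bullet> v i \<noteq> 0" "q \<bullet> v i \<noteq> 0"
    using contra pos by (auto simp: inner_add_left sgn_mult)
  have "m \<bullet> v i \<noteq> 0"
  proof
    assume "m \<bullet> v i = 0"
    then have "\<beta> * (q \<bullet> v i) = - (\<alpha> * (p \<bullet> v i))" using mv[of "v i"] by simp
    then have "sgn (\<beta> * (q \<bullet> v i)) = sgn (- (\<alpha> * (p \<bullet> v i)))" by simp
    then have "sgn (q \<bullet> v i) = - sgn (p \<bullet> v i)" using pos by (simp add: sgn_mult)
    then show False using contra \<open>m \<bullet> v i = 0\<close> by (simp add: m_def)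
  qed
  have mj: "m \<bullet> v j \<noteq> 0" "m \<bullet> v k \<noteq> 0" using j k pos by (auto simp: mv)
  \<comment> \<open>\<open>r *\<^sub>R m - p\<close> is orthogonal to \<open>v l\<close> when
    \<open>r\<close> equals \<open>ratio l\<close>, so the largest ratio gives the normal
    \<open>n\<close> next to \<open>m\<close>.\<close>
  define ratio where "ratio l = (p \<bullet> v l) / (m \<bullet> v l)" for l
  define A where "A = {l\<in>I. m \<bullet> v l \<noteq> 0}"
  define r where "r = Max (ratio ` A)"
  have A: "finite A" "i \<in> A" "j \<in> A" "k \<in> A" using fin i j k mj \<open>m \<bullet> v i \<noteq> 0\<close> by (auto simp: A_def)
  then have r_ge: "\<And>l. l \<in> A \<Longrightarrow> ratio l \<le> r" by (simp add: r_def)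
  have "r \<in> ratio ` A" unfolding r_def using A by (intro Max_in) auto
  then obtain a0 where a0: "a0 \<in> A" "ratio a0 = r" by blast
  define n where "n = r *\<^sub>R m - p"
  have nv: "n \<bullet> v l = (r - ratio l) * (m \<bullet> v l)" if "l \<in> A" for l
    using that by (simp add: n_def ratio_def A_def inner_diff_left field_simps)
  have same_sgn: "sgn (n \<bullet> v l) = sgn (m \<bullet> v l)" if "l \<in> A" "ratio l \<noteq> r" for l
    using r_ge[OF that(1)] that(2) nv[OF that(1)] by (simp add: sgn_mult)
  have ratio_j: "ratio j = 0" using j by (simp add: ratio_def)
  have ratio_k: "ratio k = 1 / \<alpha>" using k by (simp add: ratio_def mv)
  have ratio_i: "ratio i \<noteq> 0" "ratio i \<noteq> 1 / \<alpha>"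
    using \<open>p \<bullet> v i \<noteq> 0\<close> \<open>q \<bullet> v i \<noteq> 0\<close> \<open>m \<bullet> v i \<noteq> 0\<close> pos mv[of "v i"]
    by (auto simp: ratio_def field_simps)
  \<comment> \<open>The ratios of \<open>i\<close>, \<open>j\<close> and \<open>k\<close> are
    distinct, so two of them differ from the maximum.\<close>
  obtain a b where ab: "a \<in> A" "b \<in> A" "ratio a \<noteq> r" "ratio b \<noteq> r" "ratio a \<noteq> ratio b"
    using A ratio_i ratio_j ratio_k pos by (metis divide_eq_0_iff less_irrefl zero_neq_one)
  let ?K = "{l\<in>I. p \<bullet> v l = 0 \<and> q \<bullet> v l = 0}"
  have pq0: "p \<bullet> x = 0 \<and> q \<bullet> x = 0" if "m \<bullet> x = 0" "p \<bullet> x = 0" for x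
    using that pos mv[of x] by simp
  have "n \<noteq> 0" using nv[OF ab(1)] ab by (auto simp: A_def)
  have nm: "n \<bullet> x = 0 \<and> m \<bullet> x = 0 \<longleftrightarrow> p \<bullet> x = 0 \<and> q \<bullet> x = 0" for x
    using pq0[of x] mv[of x] by (auto simp: n_def inner_diff_left)
  have n: "facet_normal I v n"
  proof (rule facet_normalI)
    show "a0 \<in> I" "n \<bullet> v a0 = 0" "m \<bullet> v a0 \<noteq> 0" using a0 nv[of a0] by (auto simp: A_def)
    show "{x. n \<bullet> x = 0 \<and> m \<bullet> x = 0} \<subseteq> span (v ` {i\<in>I. n \<bullet> v i = 0 \<and> m \<bullet> v i = 0})"
      unfolding nm using sub .
  qed fact
  \<comment> \<open>Coefficients of half the difference of the two steps; on \<open>A\<close> only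
    the generators of maximal ratio keep a nonzero one.\<close>
  define c where "c l = sgn (m \<bullet> v l) - sgn (n \<bullet> v l)" for l
  define z where "z = (\<Sum>l\<in>I. c l *\<^sub>R v l)"
  have cA: "c l = (if ratio l = r then sgn (m \<bullet> v l) else 0)" if "l \<in> A" for l
    using same_sgn[OF that] nv[OF that] by (simp add: c_def)
  have c1: "\<bar>c l\<bar> \<le> 1" if "l \<in> I" for l
    using cA[of l] that by (cases "l \<in> A") (auto simp: c_def A_def sgn_if)
  have free: "span (v ` {l\<in>I. \<bar>c l\<bar> < 1}) = UNIV" (is "span ?V = _")
  proof -
    have "c l = 0" if "l \<in> ?K" for l using nm[of "v l"] that by (simp add: c_def)
    then have K: "v ` ?K \<subseteq> ?V" by auto
    have abV: "v a \<in> ?V" "v b \<in> ?V" using ab cA[of a] cA[of b] by (auto simp: A_def)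
    \<comment> \<open>Cramer's rule finds the combination of \<open>v a\<close> and
      \<open>v b\<close> with the same \<open>m\<close>- and \<open>p\<close>-values as
      \<open>x\<close>; the determinant \<open>D\<close> is nonzero since the ratios differ.\<close>
    define D where "D = (m \<bullet> v a) * (p \<bullet> v b) - (m \<bullet> v b) * (p \<bullet> v a)"
    have "D \<noteq> 0" using ab by (auto simp: D_def A_def ratio_def field_simps)
    have "x \<in> span ?V" for x
    proof -
      define e where "e = ((m \<bullet> x) * (p \<bullet> v b) - (m \<bullet> v b) * (p \<bullet> x)) / D"
      define f where "f = ((m \<bullet> v a) * (p \<bullet> x) - (m \<bullet> x) * (p \<bullet> v a)) / D"
      define y where "y = x - (e *\<^sub>R v a + f *\<^sub>R v b)"
      have eD: "e * D = (m \<bullet> x) * (p \<bullet> v b) - (m \<bullet> v b) * (p \<bullet> x)"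
        and fD: "f * D = (m \<bullet> v a) * (p \<bullet> x) - (m \<bullet> x) * (p \<bullet> v a)"
        using \<open>D \<noteq> 0\<close> by (simp_all add: e_def f_def)
      have "D * (m \<bullet> y) = D * (m \<bullet> x) - ((e * D) * (m \<bullet> v a) + (f * D) * (m \<bullet> v b))"
        by (simp add: y_def inner_diff_right inner_add_right algebra_simps)
      also have "\<dots> = 0" unfolding eD fD by (simp add: D_def algebra_simps)
      finally have my: "m \<bullet> y = 0" using \<open>D \<noteq> 0\<close> by simp
      have "D * (p \<bullet> y) = D * (p \<bullet> x) - ((e * D) * (p \<bullet> v a) + (f * D) * (p \<bullet> v b))"
        by (simp add: y_def inner_diff_right inner_add_right algebra_simps)
      also have "\<dots> = 0" unfolding eD fD by (simp add: D_def algebra_simps)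
      finally have "p \<bullet> y = 0" using \<open>D \<noteq> 0\<close> by simp
      then have "y \<in> span ?V" using pq0[OF my] sub span_mono[OF K] by blast
      then have "y + (e *\<^sub>R v a + f *\<^sub>R v b) \<in> span ?V"
        using abV by (blast intro: span_add span_scale span_base)
      then show ?thesis by (simp add: y_def)
    qed
    then show ?thesis by blast
  qed
  have z: "z \<in> interior Z"
    unfolding z_def using zono_interior[where v = v and c = c, OF fin _ free] c1 by blast
  have "(\<Sum>l\<in>I. (- c l) *\<^sub>R v l) \<in> interior Z"
    by (rule zono_interior[OF fin]) (use c1 free in auto)
  then have z': "- z \<in> interior Z" by (simp add: z_def sum_negf)
  have "facet_step I v m - facet_step I v n = 2 *\<^sub>R z"
    by (simp add: z_def c_def facet_step_def scaleR_diff_left sum_subtractf scaleR_diff_right)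
  then have diff: "facet_step I v m = facet_step I v n + 2 *\<^sub>R z" by (simp add: algebra_simps)
  \<comment> \<open>The midpoint of the two tile centers is interior to both tiles.\<close>
  have "s + facet_step I v m = s + facet_step I v n"
  proof (rule packing)
    show "s + facet_step I v m \<in> S" "s + facet_step I v n \<in> S"
      using facet_normal_step(1)[OF \<open>s \<in> S\<close>] m n by (simp_all add: m_def)
    show "(s + facet_step I v n + z) - (s + facet_step I v m) \<in> interior Z"
      using z' by (simp add: diff scaleR_2)
    show "(s + facet_step I v n + z) - (s + facet_step I v n) \<in> interior Z" using z by simp
  qed
  then have "z = 0" using diff by simp
  \<comment> \<open>The generator \<open>a0\<close> of maximal ratio contributes positively, so the
    two positions differ after all.\<close>
  moreover have "m \<bullet> z > 0"
  proof -
    have "c l * (m \<bullet> v l) \<ge> 0" if "l \<in> I" for l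
      using cA[of l] that by (cases "l \<in> A") (auto simp: A_def sgn_if)
    moreover have "c a0 * (m \<bullet> v a0) > 0" using cA[OF a0(1)] a0 by (auto simp: A_def sgn_if)
    moreover have "a0 \<in> I" using a0 by (simp add: A_def)
    ultimately have "(\<Sum>l\<in>I. c l * (m \<bullet> v l)) > 0" by (intro sum_pos2[OF fin, of a0])
    then show ?thesis by (simp add: z_def inner_sum_right)
  qed
  ultimately show False by simp
qed

lemma pencil_step_add:
  assumes "s \<in> S" and "facet_normal I v (\<alpha> *\<^sub>R p + \<beta> *\<^sub>R q)" and "\<alpha> > 0" "\<beta> > 0"
    and "j \<in> I" "p \<bullet> v j = 0" "q \<bullet> v j \<noteq> 0"
    and "k \<in> I" "q \<bullet> v k = 0" "p \<bullet> v k \<noteq> 0"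
    and "{x. p \<bullet> x = 0 \<and> q \<bullet> x = 0} \<subseteq> span (v ` {i\<in>I. p \<bullet> v i = 0 \<and> q \<bullet> v i = 0})"
  shows "facet_step I v (\<alpha> *\<^sub>R p + \<beta> *\<^sub>R q) = facet_step I v p + facet_step I v q"
proof -
  have "(\<Sum>i\<in>I. sgn ((\<alpha> *\<^sub>R p + \<beta> *\<^sub>R q) \<bullet> v i) *\<^sub>R v i) =
    (\<Sum>i\<in>I. (sgn (p \<bullet> v i) + sgn (q \<bullet> v i)) *\<^sub>R v i)"
    using pencil_sgn_add[OF assms] by (intro sum.cong) auto
  then show ?thesis
    by (simp add: facet_step_def scaleR_add_left sum.distrib scaleR_add_right)
qed

section \<open>The lattice basis\<close>

text \<open>\<open>N\<close> is dual to \<open>C\<close> up to scale. Splitting \<open>m\<close> in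
  a pencil yields normals orthogonal to at least one more vector of \<open>C\<close>; when only
  \<open>c\<close> is left, \<open>m\<close> is a multiple of \<open>N c\<close>.\<close>

lemma facet_steps_generated:
  assumes "s \<in> S" and C: "C \<subseteq> v ` I" "independent C" "span C = UNIV"
    and N: "\<forall>c\<in>C. N c \<bullet> c \<noteq> 0 \<and> (\<forall>c'\<in>C - {c}. N c \<bullet> c' = 0)"
    and "facet_normal I v m"
  shows "facet_step I v m \<in> int_span ((\<lambda>c. facet_step I v (N c)) ` C)"
  using \<open>facet_normal I v m\<close>
proof (induction "card {c\<in>C. m \<bullet> c \<noteq> 0}" arbitrary: m rule: less_induct)
  case less
  let ?L = "int_span ((\<lambda>c. facet_step I v (N c)) ` C)"
  have finC: "finite C" using C(1) fin finite_surj by blast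
  have m0: "m \<noteq> 0" and msp: "{x. m \<bullet> x = 0} \<subseteq> span (v ` {i\<in>I. m \<bullet> v i = 0})"
    using less.prems by (auto simp: facet_normal_def)
  obtain c where c: "c \<in> C" "m \<bullet> c \<noteq> 0" using orthogonal_spanning_imp_zero[OF C(3), of m] m0 by blast
  show ?case
  proof (cases "\<forall>c'\<in>C. m \<bullet> c' \<noteq> 0 \<longrightarrow> c' = c")
    case single: True
    define r where "r = (m \<bullet> c) / (N c \<bullet> c)"
    have "(m - r *\<^sub>R N c) \<bullet> c' = 0" if "c' \<in> C" for c'
    proof (cases "c' = c")
      case True
      then show ?thesis using bspec[OF N c(1)] by (simp add: r_def inner_diff_left)
    next
      case False
      then have "m \<bullet> c' = 0" "N c \<bullet> c' = 0" using single N c that by blast+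
      then show ?thesis by (simp add: inner_diff_left)
    qed
    then have "m - r *\<^sub>R N c = 0" by (rule orthogonal_spanning_imp_zero[OF C(3)])
    then have "m = r *\<^sub>R N c" by simp
    then have "facet_step I v m = sgn r *\<^sub>R facet_step I v (N c)" by (simp only: facet_step_scale)
    moreover have "facet_step I v (N c) \<in> ?L" using finC c by (intro int_span_base) auto
    ultimately show ?thesis by (simp add: sgn_if int_span_zero int_span_uminus)
  next
    case False
    then obtain c' where c': "c' \<in> C" "m \<bullet> c' \<noteq> 0" "c' \<noteq> c" by blast
    \<comment> \<open>\<open>E\<close> is extended by generators to a basis \<open>B\<close> of the
      hyperplane normal to \<open>m\<close>.\<close>
    define E where "E = {c\<in>C. m \<bullet> c = 0}"
    have indE: "independent E" using C(2) by (rule independent_mono) (auto simp: E_def)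
    have "E \<subseteq> v ` {i\<in>I. m \<bullet> v i = 0}" using C(1) by (auto simp: E_def)
    then obtain B where B: "E \<subseteq> B" "B \<subseteq> v ` {i\<in>I. m \<bullet> v i = 0}" "independent B"
      "v ` {i\<in>I. m \<bullet> v i = 0} \<subseteq> span B"
      by (rule maximal_independent_subset_extend[OF _ indE]) blast
    have Bsp: "{x. m \<bullet> x = 0} \<subseteq> span B" using msp span_mono[OF B(4)] by (simp add: span_span)
    \<comment> \<open>Otherwise \<open>E\<close> would span the hyperplane, and the combination
      \<open>w\<close> of \<open>c\<close> and \<open>c'\<close> orthogonal to \<open>m\<close>
      would put \<open>c\<close> in the span of the rest of \<open>C\<close>.\<close>
    have "\<exists>b\<in>B. b \<notin> E"
    proof (rule ccontr)
      assume "\<not> (\<exists>b\<in>B. b \<notin> E)"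
      then have "B \<subseteq> E" by blast
      define w where "w = c - ((m \<bullet> c) / (m \<bullet> c')) *\<^sub>R c'"
      have "m \<bullet> w = 0" using c' by (simp add: w_def inner_diff_right)
      then have "w \<in> span E" using Bsp span_mono[OF \<open>B \<subseteq> E\<close>] by blast
      moreover have "E \<subseteq> C - {c}" using c by (auto simp: E_def)
      ultimately have "w \<in> span (C - {c})" using span_mono by blast
      moreover have "((m \<bullet> c) / (m \<bullet> c')) *\<^sub>R c' \<in> span (C - {c})"
        using c' by (intro span_scale span_base) auto
      ultimately have "w + ((m \<bullet> c) / (m \<bullet> c')) *\<^sub>R c' \<in> span (C - {c})" by (rule span_add)
      then show False using C(2) c by (auto simp: w_def dependent_def)
    qed
    then obtain b where b: "b \<in> B" "b \<notin> E" by blast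
    have "b \<notin> span (B - {b})" using B(3) b by (auto simp: dependent_def)
    \<comment> \<open>\<open>m\<close> and \<open>e\<close> cut out the span of
      \<open>B - {b}\<close>, a subspace of codimension two containing \<open>E\<close>.\<close>
    then obtain e where e: "e \<bullet> b \<noteq> 0" "\<forall>x\<in>B - {b}. e \<bullet> x = 0"
      using orthogonal_functional_exists by blast
    have mb: "m \<bullet> x = 0" if "x \<in> B" for x using B(2) that by auto
    have eE: "e \<bullet> x = 0" if "x \<in> E" for x using that B(1) b(2) e(2) by auto
    \<comment> \<open>For \<open>c\<close> outside \<open>E\<close>,
      \<open>e - q c *\<^sub>R m\<close> is the normal in the pencil orthogonal to \<open>c\<close>.
      Were \<open>q\<close> constant there, \<open>e\<close> would be a multiple of
      \<open>m\<close>, contrary to \<open>e \<bullet> b \<noteq> 0\<close>.\<close>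
    define q where "q c = (e \<bullet> c) / (m \<bullet> c)" for c
    have "\<exists>c1\<in>C - E. \<exists>c2\<in>C - E. q c1 < q c2"
    proof (rule ccontr)
      assume "\<not> ?thesis"
      then have eq: "q x = q c" if "x \<in> C - E" for x
        using that c by (cases "q x" "q c" rule: linorder_cases) (auto simp: E_def)
      have "(e - q c *\<^sub>R m) \<bullet> x = 0" if "x \<in> C" for x
      proof (cases "x \<in> E")
        case True
        then show ?thesis using eE by (simp add: E_def inner_diff_left)
      next
        case False
        then have "q c = e \<bullet> x / (m \<bullet> x)" "m \<bullet> x \<noteq> 0" using eq[of x] that by (auto simp: q_def E_def)
        then show ?thesis by (simp add: inner_diff_left)
      qed
      then have "e - q c *\<^sub>R m = 0" by (rule orthogonal_spanning_imp_zero[OF C(3)])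
      then have "e \<bullet> b = q c * (m \<bullet> b)" by (metis eq_iff_diff_eq_0 inner_scaleR_left)
      then show False using e(1) mb[OF b(1)] by simp
    qed
    then obtain c1 c2 where c12: "c1 \<in> C" "m \<bullet> c1 \<noteq> 0" "c2 \<in> C" "m \<bullet> c2 \<noteq> 0" "q c1 < q c2"
      by (auto simp: E_def)
    obtain j where j: "j \<in> I" "c1 = v j" using C(1) c12 by blast
    obtain k where k: "k \<in> I" "c2 = v k" using C(1) c12 by blast
    \<comment> \<open>\<open>p1\<close> is orthogonal to \<open>c1\<close> and \<open>p2\<close> to
      \<open>c2\<close>; \<open>e\<close> cancels in their sum, which is a positive multiple of
      \<open>m\<close> because \<open>q c1 < q c2\<close>.\<close>
    define p1 where "p1 = e - q c1 *\<^sub>R m"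
    define p2 where "p2 = q c2 *\<^sub>R m - e"
    define \<alpha> where "\<alpha> = 1 / (q c2 - q c1)"
    have "\<alpha> > 0" using c12 by (simp add: \<alpha>_def)
    have m_eq: "m = \<alpha> *\<^sub>R p1 + \<alpha> *\<^sub>R p2"
    proof -
      have "p1 + p2 = (q c2 - q c1) *\<^sub>R m" by (simp add: p1_def p2_def scaleR_diff_left)
      then have "\<alpha> *\<^sub>R (p1 + p2) = m" using c12 by (simp add: \<alpha>_def)
      then show ?thesis by (simp add: scaleR_add_right)
    qed
    have p1j: "p1 \<bullet> v j = 0" and p2k: "p2 \<bullet> v k = 0"
      using c12 j k by (auto simp: p1_def p2_def q_def inner_diff_left)
    have "m \<bullet> v j = \<alpha> * (p1 \<bullet> v j) + \<alpha> * (p2 \<bullet> v j)" "m \<bullet> v k = \<alpha> * (p1 \<bullet> v k) + \<alpha> * (p2 \<bullet> v k)"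
      by (subst m_eq, simp add: inner_add_left)+
    then have p2j: "p2 \<bullet> v j \<noteq> 0" and p1k: "p1 \<bullet> v k \<noteq> 0" using p1j p2k c12 j k by auto
    have sub: "{x. p1 \<bullet> x = 0 \<and> p2 \<bullet> x = 0} \<subseteq> span (v ` {i\<in>I. p1 \<bullet> v i = 0 \<and> p2 \<bullet> v i = 0})"
    proof
      fix x assume x: "x \<in> {x. p1 \<bullet> x = 0 \<and> p2 \<bullet> x = 0}"
      have "m \<bullet> x = 0" by (subst m_eq) (use x in \<open>simp add: inner_add_left\<close>)
      moreover from this have "e \<bullet> x = 0" using x by (simp add: p1_def inner_diff_left)
      ultimately have "x \<in> span (B - {b})"
        using orthogonal_imp_in_span_remove[OF _ b(1) e] Bsp by blast
      moreover have "B - {b} \<subseteq> v ` {i\<in>I. p1 \<bullet> v i = 0 \<and> p2 \<bullet> v i = 0}"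
        using B(2) e(2) mb by (fastforce simp: p1_def p2_def inner_diff_left)
      ultimately show "x \<in> span (v ` {i\<in>I. p1 \<bullet> v i = 0 \<and> p2 \<bullet> v i = 0})" using span_mono by blast
    qed
    have "p1 \<noteq> 0" "p2 \<noteq> 0" using p1k p2j by auto
    have fn: "facet_normal I v p1" "facet_normal I v p2"
      using facet_normalI[where v = v and p = p1, OF j(1) p1j p2j \<open>p1 \<noteq> 0\<close> sub]
        facet_normalI[where v = v and p = p2, OF k(1) p2k p1k \<open>p2 \<noteq> 0\<close>] sub
      by (simp_all add: conj_commute)
    \<comment> \<open>The counts drop strictly: orthogonality to \<open>E\<close> persists, and
      \<open>c1\<close> or \<open>c2\<close> is gained.\<close>
    have "p1 \<bullet> x = 0 \<and> p2 \<bullet> x = 0" if "x \<in> C" "m \<bullet> x = 0" for x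
      using eE[of x] that by (simp add: E_def p1_def p2_def inner_diff_left)
    then have "{c\<in>C. p1 \<bullet> c \<noteq> 0} \<subset> {c\<in>C. m \<bullet> c \<noteq> 0}" "{c\<in>C. p2 \<bullet> c \<noteq> 0} \<subset> {c\<in>C. m \<bullet> c \<noteq> 0}"
      using c12 p1j p2k j k by blast+
    then have "facet_step I v p1 \<in> ?L" "facet_step I v p2 \<in> ?L"
      using less.hyps fn psubset_card_mono[of "{c\<in>C. m \<bullet> c \<noteq> 0}"] finC by auto
    moreover have "facet_step I v m = facet_step I v p1 + facet_step I v p2"
      using pencil_step_add[OF \<open>s \<in> S\<close> _ \<open>\<alpha> > 0\<close> \<open>\<alpha> > 0\<close> j(1) p1j p2j k(1) p2k p1k sub] less.prems
      by (simp add: m_eq[symmetric])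
    ultimately show ?thesis using int_span_add by metis
  qed
qed

text \<open>A generic segment from the tile at \<open>s0\<close> to a tile outside \<open>L\<close> avoids the faces of codimension
  at least two, hence it leaves the union of the tiles of \<open>L\<close> through the relative interior of a facet.\<close>

lemma tiles_connected:
  assumes L: "L \<subseteq> S" "s0 \<in> L"
    and step: "\<And>l m. l \<in> L \<Longrightarrow> facet_normal I v m \<Longrightarrow> l + facet_step I v m \<in> L"
  shows "L = S"
proof (rule ccontr)
  assume "L \<noteq> S"
  then obtain s where s: "s \<in> S" "s \<notin> L" using L by blast
  \<comment> \<open>Points of the tile at \<open>l\<close> with free coefficients on
    \<open>F\<close> and otherwise 1 on \<open>P\<close>, -1 off \<open>P\<close>, lie in the flat
    through \<open>vert l F P\<close> along the generators in \<open>F\<close>. \<open>bad\<close>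
    joins this flat to \<open>s0\<close>; in codimension at least two the join is still
    negligible.\<close>
  define vert where "vert l F P = l + (\<Sum>i\<in>I - F. (if i \<in> P then 1 else -1) *\<^sub>R v i)" for l F P
  define bad where "bad = (\<lambda>(l, F, P). (+) s0 ` span (insert (vert l F P - s0) (v ` F)))"
  define X where "X = {(l, F, P). l \<in> S \<and> F \<subseteq> I \<and> P \<subseteq> I \<and> dim (v ` F) + 2 \<le> DIM('a)}"
  have "X \<subseteq> S \<times> Pow I \<times> Pow I" by (auto simp: X_def)
  moreover have "countable (S \<times> Pow I \<times> Pow I)"
    using countable_tiles fin by (intro countable_SIGMA) (auto intro: countable_finite)
  ultimately have "countable X" using countable_subset by blast
  have "negligible (bad t)" if t: "t \<in> X" for t
  proof -
    obtain l F P where lF: "t = (l, F, P)" "dim (v ` F) + 2 \<le> DIM('a)" using t by (auto simp: X_def)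
    have "dim (span (insert (vert l F P - s0) (v ` F))) \<le> dim (v ` F) + 1"
      by (simp add: dim_insert)
    then have "negligible (span (insert (vert l F P - s0) (v ` F)))"
      using lF by (intro negligible_lowdim) linarith
    then show ?thesis by (simp add: lF bad_def negligible_translation)
  qed
  then have "negligible (\<Union>t\<in>X. bad t)" using \<open>countable X\<close>
    by (intro negligible_countable_Union) auto
  moreover have "open ((+) s ` interior Z)" "(+) s ` interior Z \<noteq> {}"
    using zero_interior by (auto intro: open_translation)
  ultimately obtain z where z: "z \<in> (+) s ` interior Z" "z \<notin> (\<Union>t\<in>X. bad t)"
    using open_not_negligible negligible_subset by (metis subsetI)
  \<comment> \<open>Both unions are closed and together cover the connected segment, so some
    \<open>x\<close> on it lies in a tile of \<open>L\<close> and in a tile outside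
    \<open>L\<close>.\<close>
  let ?U = "{x. \<exists>l\<in>L. x - l \<in> Z}" and ?V = "{x. \<exists>l\<in>S - L. x - l \<in> Z}"
  have "closed ?U" "closed ?V" using L by (auto intro!: closed_tiles_Union)
  moreover have "closed_segment s0 z \<subseteq> ?U \<union> ?V" using covering by blast
  moreover have "s0 \<in> ?U \<inter> closed_segment s0 z"
    using L zero_in_zono[of I v] by force
  moreover have "z \<in> ?V \<inter> closed_segment s0 z"
    using s z(1) interior_subset[of Z] by (auto simp: mem_translation_iff)
  ultimately have "?U \<inter> ?V \<inter> closed_segment s0 z \<noteq> {}"
    using connected_closedD[OF connected_segment(1)[of s0 z], of ?U ?V] by blast
  then obtain x l s' where x: "x \<in> closed_segment s0 z" and l: "l \<in> L" "x - l \<in> Z"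
    and s': "s' \<in> S" "s' \<notin> L" "x - s' \<in> Z" by blast
  have "l \<noteq> s'" "l \<in> S" using l s' L by auto
  then have "x - l \<notin> interior Z" using packing_closed s' by blast
  obtain c where c: "x - l = (\<Sum>i\<in>I. c i *\<^sub>R v i)" "\<forall>i\<in>I. \<bar>c i\<bar> \<le> 1" using l(2) unfolding zono_def by blast
  obtain m where m: "m \<noteq> 0" "\<forall>i\<in>I. m \<bullet> v i \<noteq> 0 \<longrightarrow> c i = sgn (m \<bullet> v i)"
    using zono_boundary[where v = v and c = c, OF fin c(2)] \<open>x - l \<notin> interior Z\<close> c(1) by auto
  define F where "F = {i\<in>I. \<bar>c i\<bar> < 1}"
  have mF: "m \<bullet> v i = 0" if "i \<in> F" for i
    using m(2) that by (force simp: F_def sgn_if split: if_splits)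
  show False
  proof (cases "dim (v ` F) + 2 \<le> DIM('a)")
    case False
    \<comment> \<open>The generators in \<open>F\<close> span the hyperplane normal to
      \<open>m\<close>, so \<open>x\<close> lies in the relative interior of a facet and
      \<open>s'\<close> is a neighbour of \<open>l\<close>.\<close>
    have "span (v ` F) \<subseteq> {x. m \<bullet> x = 0}"
      using mF by (intro span_minimal subspace_hyperplane) auto
    moreover have "dim {x. m \<bullet> x = 0} \<le> dim (span (v ` F))"
      using False dim_hyperplane[OF m(1)] by simp
    ultimately have "span (v ` F) = {x. m \<bullet> x = 0}"
      by (intro subspace_dim_equal subspace_hyperplane subspace_span)
    then have F: "{x. m \<bullet> x = 0} \<subseteq> span (v ` {i\<in>I. \<bar>c i\<bar> < 1})" by (simp add: F_def)
    then have "s' = l + facet_step I v m"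
      using facet_neighbour(1)[OF \<open>l \<in> S\<close> s'(1) \<open>l \<noteq> s'\<close> m(1) c(2) m(2) F c(1) s'(3)] by blast
    moreover have "facet_normal I v m"
      using m(1) F span_mono[of "v ` F" "v ` {i\<in>I. m \<bullet> v i = 0}"] mF
      by (auto simp: facet_normal_def F_def)
    ultimately show False using step[OF l(1)] s'(2) by blast
  next
    case True
    \<comment> \<open>Here \<open>x\<close> lies on a flat of codimension at least two; unless
      \<open>x\<close> is \<open>s0\<close>, the line from \<open>s0\<close> through
      \<open>x\<close> puts \<open>z\<close> into \<open>bad\<close>.\<close>
    define P where "P = {i\<in>I. c i = 1}"
    have t: "(l, F, P) \<in> X" using True \<open>l \<in> S\<close> by (auto simp: X_def F_def P_def)
    let ?W = "span (insert (vert l F P - s0) (v ` F))"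
    have "(\<Sum>i\<in>I. c i *\<^sub>R v i) = (\<Sum>i\<in>I - F. c i *\<^sub>R v i) + (\<Sum>i\<in>F. c i *\<^sub>R v i)"
      using fin by (intro sum.subset_diff) (auto simp: F_def)
    also have "(\<Sum>i\<in>I - F. c i *\<^sub>R v i) = (\<Sum>i\<in>I - F. (if i \<in> P then 1 else -1) *\<^sub>R v i)"
      using c(2) by (intro sum.cong) (fastforce simp: F_def P_def)+
    finally have "x - s0 = (vert l F P - s0) + (\<Sum>i\<in>F. c i *\<^sub>R v i)"
      using c(1) by (simp add: vert_def algebra_simps)
    also have "\<dots> \<in> ?W"
      by (intro span_add span_sum span_scale) (auto intro: span_base)
    finally have xW: "x - s0 \<in> ?W" .
    obtain \<tau> where \<tau>: "0 \<le> \<tau>" "x = (1 - \<tau>) *\<^sub>R s0 + \<tau> *\<^sub>R z" using x by (auto simp: in_segment)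
    then have xz: "x - s0 = \<tau> *\<^sub>R (z - s0)" by (simp add: algebra_simps)
    show False
    proof (cases "\<tau> = 0")
      case True
      then have "s0 = s'" using packing_closed[of s0 s' x] zero_interior xz L s' by auto
      then show False using L s' by blast
    next
      case False
      then have "z - s0 = (1 / \<tau>) *\<^sub>R (x - s0)" using xz by simp
      then have "z - s0 \<in> ?W" using xW span_scale by metis
      then have "z \<in> bad (l, F, P)" by (simp add: bad_def mem_translation_iff)
      then show False using z(2) t by blast
    qed
  qed
qed

text \<open>A basis \<open>C\<close> of generators yields at most \<open>DIM('a)\<close> steps,
  whose integer combinations reach every tile by \<open>tiles_connected\<close>. Since the tiles
  cover the space, the steps span it, and by counting they are independent.\<close>

theorem tile_positions_basis:
  assumes "s \<in> S"
  shows "\<exists>B. B \<subseteq> facet_step I v ` {m. facet_normal I v m} \<and> card B = DIM('a) \<and> finite B \<and>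
    independent B \<and> S = (+) s ` int_span B"
proof -
  obtain C where C: "C \<subseteq> v ` I" "independent C" "v ` I \<subseteq> span C"
    by (rule maximal_independent_subset[of "v ` I"]) blast
  have Csp: "span C = UNIV" using span_mono[OF C(3)] spanning by (simp add: span_span top.extremum_unique)
  have finC: "finite C" using C(1) fin finite_surj by blast
  have cardC: "card C = DIM('a)" using indep_card_eq_dim_span[OF C(2)] Csp by simp
  have "\<forall>c\<in>C. \<exists>n. n \<bullet> c \<noteq> 0 \<and> (\<forall>c'\<in>C - {c}. n \<bullet> c' = 0)"
    using C(2) orthogonal_functional_exists unfolding dependent_def by blast
  then obtain N where N: "\<forall>c\<in>C. N c \<bullet> c \<noteq> 0 \<and> (\<forall>c'\<in>C - {c}. N c \<bullet> c' = 0)" by metis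
  define B where "B = (\<lambda>c. facet_step I v (N c)) ` C"
  have fN: "facet_normal I v (N c)" if c: "c \<in> C" for c
    unfolding facet_normal_def
  proof (intro conjI subsetI)
    show "N c \<noteq> 0" using N c by force
    fix x assume "x \<in> {x. N c \<bullet> x = 0}"
    then have "x \<in> span (C - {c})"
      using orthogonal_imp_in_span_remove[of x C c "N c"] N c Csp by auto
    moreover have "C - {c} \<subseteq> v ` {i\<in>I. N c \<bullet> v i = 0}" using N c C(1) by fastforce
    ultimately show "x \<in> span (v ` {i\<in>I. N c \<bullet> v i = 0})" using span_mono by blast
  qed
  have finB: "finite B" using finC by (simp add: B_def)
  have BS: "s' + b \<in> S \<and> s' - b \<in> S" if b: "b \<in> B" and s': "s' \<in> S" for b s'
  proof -
    obtain m where m: "facet_normal I v m" "b = facet_step I v m" using b fN by (auto simp: B_def)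
    then show ?thesis using facet_normal_step(1)[OF s' m(1)] facet_normal_step(1)[OF s', of "- m"]
      by (simp add: facet_normal_uminus facet_step_uminus)
  qed
  have SB: "(+) s ` int_span B = S"
  proof (rule tiles_connected)
    show "(+) s ` int_span B \<subseteq> S"
      using closed_under_int_span[OF finB BS assms] by blast
    show "s \<in> (+) s ` int_span B" using int_span_zero by force
    fix l m assume "l \<in> (+) s ` int_span B" "facet_normal I v m"
    then show "l + facet_step I v m \<in> (+) s ` int_span B"
      using facet_steps_generated[OF assms C(1,2) Csp N]
      by (auto simp: B_def add.assoc intro!: imageI int_span_add)
  qed
  have Bsp: "span B = UNIV"
  proof (rule ccontr)
    assume "span B \<noteq> UNIV"
    then obtain e where e: "e \<noteq> 0" "\<forall>x\<in>span B. e \<bullet> x = 0" using span_not_UNIV_orthogonal by blast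
    \<comment> \<open>All centers have the same \<open>e\<close>-value as \<open>s\<close>, so the
      tiles lie in a slab; \<open>r\<close> puts \<open>s + r *\<^sub>R e\<close> beyond it.\<close>
    define r where "r = (e \<bullet> facet_step I v e / 2 + 1) / (e \<bullet> e)"
    obtain s' where s': "s' \<in> S" "(s + r *\<^sub>R e) - s' \<in> Z" using covering by blast
    then obtain d where d: "d \<in> int_span B" "s' = s + d" using SB by blast
    have "e \<bullet> d = 0" using d int_span_subset_span e by blast
    then have "e \<bullet> ((s + r *\<^sub>R e) - s') = e \<bullet> facet_step I v e / 2 + 1"
      using e(1) by (simp add: d r_def inner_diff_right inner_add_right)
    then show False using zono_inner_le[OF s'(2), of e] by simp
  qed
  have "card B \<le> DIM('a)" using card_image_le[OF finC] cardC by (metis B_def)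
  then have indB: "independent B"
    using card_le_dim_spanning[of B UNIV] Bsp finB by simp
  moreover have "card B = DIM('a)" using indep_card_eq_dim_span[OF indB] Bsp by simp
  ultimately show ?thesis using finB SB fN by (intro exI[of _ B]) (auto simp: B_def)
qed

end

section \<open>From positions back to tiles and their centers\<close>

lemma center_translation_zono:
  assumes "bounded (zono I v)"
  shows "center ((+) s ` zono I v) = s"
proof (rule center_eqI)
  show "bounded ((+) s ` zono I v)" using assms by (rule bounded_translation)
  show "(+) s ` zono I v \<noteq> {}" using zero_in_zono by blast
  have "(\<lambda>x. 2 *\<^sub>R s - x) ` (+) s ` zono I v = (+) s ` uminus ` zono I v"
    by (simp add: image_image scaleR_2)
  also have "uminus ` zono I v = zono I v"
    using zono_uminus by (force simp: image_iff)
  finally show "center_of_symmetry ((+) s ` zono I v) s" by (simp add: center_of_symmetry_def)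
qed

theorem theorem4p2:
  fixes Z :: "'a::euclidean_space set" and \<T> :: "'a set set"
  assumes "zonotope Z"
    and "aff_dim Z = int DIM('a)"
    and "parallelohedron Z"
    and "tiling_by_translates Z \<T>"
    and "face_to_face \<T>"
    and "Z \<in> \<T>"
  shows "\<exists>B. B \<subseteq> facet_vectors Z \<T> \<and> card B = DIM('a) \<and> lattice_basis B (center_lattice Z \<T>)"
proof -
  obtain n and a b :: "nat \<Rightarrow> 'a" where "Z = (\<Sum>i<n. closed_segment (a i) (b i))"
    using assms(1) unfolding zonotope_def by blast
  then obtain I :: "nat set" and v c where "finite I" and Z: "Z = (+) c ` zono I v"
    using segment_sum_eq_zono[of "{..<n}" a b] by blast
  define S where "S = {s. (+) s ` zono I v \<in> \<T>}"
  note tiling = assms(4)[unfolded tiling_by_translates_def]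
  have tile: "\<exists>s\<in>S. A = (+) s ` zono I v" if "A \<in> \<T>" for A
  proof -
    obtain t where "A = (+) t ` Z" using bspec[OF conjunct1[OF tiling] \<open>A \<in> \<T>\<close>] ..
    then have "A = (+) (t + c) ` zono I v" by (simp add: Z image_image add.assoc)
    then show ?thesis using that by (auto simp: S_def)
  qed
  have poly: "polytope (zono I v)"
    using assms(3) by (simp add: parallelohedron_def Z polytope_translation_eq)
  have bdd: "bounded (zono I v)" using poly polytope_imp_bounded by blast
  have center: "center ((+) s ` zono I v) = s" for s using center_translation_zono[OF bdd] .
  interpret zonotopal_tiling I v S
  proof
    show "finite I" by fact
    show "polytope (zono I v)" by fact
    \<comment> \<open>The full-dimensional zonotope lies in the span of its generators.\<close>
    have "aff_dim (zono I v) \<le> aff_dim (span (v ` I))"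
      by (intro aff_dim_subset) (auto elim!: zonoE intro: span_sum span_scale span_base)
    then have "DIM('a) \<le> dim (span (v ` I))"
      using assms(2) by (simp add: Z aff_dim_translation_eq aff_dim_subspace)
    then show "span (v ` I) = UNIV"
      using dim_eq_full[of "v ` I"] dim_subset_UNIV[of "v ` I"] by simp
    show "\<exists>s\<in>S. x - s \<in> zono I v" for x
    proof -
      have "x \<in> \<Union>\<T>" using tiling by simp
      then show ?thesis using tile mem_translation_iff by (metis UnionE)
    qed
    show "s = s'" if "s \<in> S" "s' \<in> S" "x - s \<in> interior (zono I v)" "x - s' \<in> interior (zono I v)" for s s' x
    proof -
      have "x \<in> interior ((+) s ` zono I v) \<inter> interior ((+) s' ` zono I v)"
        using that by (simp add: interior_translation mem_translation_iff)
      then have "(+) s ` zono I v = (+) s' ` zono I v"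
        using that conjunct2[OF conjunct2[OF tiling]] unfolding S_def by blast
      \<comment> \<open>A tile determines its position, which is its center.\<close>
      then show ?thesis using center by metis
    qed
    show "((+) s ` zono I v \<inter> (+) s' ` zono I v) face_of (+) s ` zono I v" if "s \<in> S" "s' \<in> S" for s s'
      using that assms(5) by (simp add: face_to_face_def S_def)
  qed
  have "c \<in> S" using assms(6) Z by (simp add: S_def)
  then obtain B where B: "B \<subseteq> facet_step I v ` {m. facet_normal I v m}" "card B = DIM('a)" "finite B"
    "independent B" "S = (+) c ` int_span B"
    using tile_positions_basis by blast
  have cZ: "center Z = c" using center Z by simp
  have "center_lattice Z \<T> = (\<lambda>s. s - c) ` S"
  proof (intro set_eqI iffI)
    fix x assume "x \<in> center_lattice Z \<T>"
    then obtain A where "A \<in> \<T>" "x = center A - c" by (auto simp: center_lattice_def cZ)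
    then show "x \<in> (\<lambda>s. s - c) ` S" using tile[of A] center by auto
  next
    fix x assume "x \<in> (\<lambda>s. s - c) ` S"
    then obtain s where "(+) s ` zono I v \<in> \<T>" "x = s - c" by (auto simp: S_def)
    then show "x \<in> center_lattice Z \<T>" unfolding center_lattice_def cZ
      by (intro CollectI exI[of _ "(+) s ` zono I v"]) (simp add: center)
  qed
  also have "\<dots> = (\<lambda>s. s - c) ` (+) c ` int_span B" by (simp only: B(5)[symmetric])
  also have "\<dots> = int_span B" by (simp add: image_image)
  finally have "lattice_basis B (center_lattice Z \<T>)"
    using B by (simp add: lattice_basis_def int_span_def)
  moreover have "B \<subseteq> facet_vectors Z \<T>"
  proof
    fix b assume "b \<in> B"
    then obtain m where m: "facet_normal I v m" "b = facet_step I v m" using B(1) by blast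
    let ?A = "(+) (c + b) ` zono I v"
    have "c + b \<in> S" "c + b \<noteq> c" using facet_normal_step(1,2)[OF \<open>c \<in> S\<close> m(1)] m(2) by simp_all
    then have "?A \<in> \<T>" "?A \<noteq> Z" using cZ center[of "c + b"] by (auto simp: S_def)
    moreover have "\<exists>F. F facet_of Z \<and> F facet_of ?A"
      using common_facet[OF \<open>c \<in> S\<close> m(1)] m(2) Z by simp
    moreover have "b = center ?A - center Z" by (simp add: center cZ)
    ultimately show "b \<in> facet_vectors Z \<T>" unfolding facet_vectors_def by blast
  qed
  ultimately show ?thesis using B(2) by blast
qed

end
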